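(* Let $f(n)\in\mathbb{Z}$, $n\in\mathbb{N}$, be a strictly convex integer sequence such that for some real $\tau>0$ and all sufficiently large $N$, $$\frac1N\sum_{n=1}^N|f(n)|\ll N^\tau.$$ Then for every real $\alpha\in(1/2,1)$, $$\dim\mathcal{F}_{f,\alpha}\leqslant\min\{U_1(\tau,\alpha),U_2(\tau,\alpha)\},$$ where $$U_1(\tau,\alpha)=\frac{\tau+45/13-5\alpha}{\tau+1-\alpha},\qquad U_2(\tau,\alpha)=\inf_{k\in\mathbb{N},\,k\geqslant 3}\frac{\tau-\alpha+2k-1+2^{-k+1}-2k\alpha}{\tau+1-\alpha},$$ and $\dim$ denotes Hausdorff dimension.
   Context: Write $\mathbf{e}(z)=\exp(2\pi i z)$ and $\mathsf{T}=[0,1]$. For a real sequence $f(n)$, $x\in\mathsf{T}$ and $N\in\mathbb{N}$ let $V_f(x;N)=\sum_{n=1}^N\mathbf{e}(xf(n))$, and for $\alpha\in(1/2,1)$ let $\mathcal{F}_{f,\alpha}=\{x\in\mathsf{T}:\ |V_f(x;N)|\geqslant N^\alpha\text{ for infinitely many }N\in\mathbb{N}\}$. The notation $U\ll V$ means $|U|\leqslant cV$ for some constant $c>0$ independent of the varying parameters. *)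

theory Defs
  imports "HOL-Analysis.Analysis"
begin

text \<open>
  The covering sets are required to be bounded because \<open>diameter\<close> is unspecified on unbounded sets.
  Only exponents \<open>s > 0\<close> are meaningful here: \<open>0 powr 0 = 0\<close>, so \<open>s = 0\<close> would not give
  the counting measure.
\<close>

definition hausdorff_premeasure :: "real \<Rightarrow> real \<Rightarrow> 'a::metric_space set \<Rightarrow> ennreal" where
  "hausdorff_premeasure \<delta> s A =
     (INF U \<in> {U :: nat \<Rightarrow> 'a set. A \<subseteq> (\<Union>i. U i) \<and> (\<forall>i. bounded (U i) \<and> diameter (U i) \<le> \<delta>)}.
        \<Sum>i. ennreal (diameter (U i) powr s))"

definition hausdorff_measure :: "real \<Rightarrow> 'a::metric_space set \<Rightarrow> ennreal" where
  "hausdorff_measure s A = (SUP \<delta> \<in> {0<..}. hausdorff_premeasure \<delta> s A)"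

definition hausdorff_dim :: "'a::metric_space set \<Rightarrow> ereal" where
  "hausdorff_dim A = (INF s \<in> {s. 0 < s \<and> hausdorff_measure s A = 0}. ereal s)"

definition additive_char :: "complex \<Rightarrow> complex" where
  "additive_char z = exp (2 * of_real pi * \<i> * z)"

text \<open>
  Sequences are indexed by the positive integers; the value at \<open>0\<close> of a function on
  \<open>nat\<close> is irrelevant in everything below.
\<close>

definition weyl_sum :: "(nat \<Rightarrow> real) \<Rightarrow> real \<Rightarrow> nat \<Rightarrow> complex" where
  "weyl_sum f x N = (\<Sum>n=1..N. additive_char (of_real (x * f n)))"

definition large_sum_set :: "(nat \<Rightarrow> real) \<Rightarrow> real \<Rightarrow> real set" where
  "large_sum_set f \<alpha> = {x \<in> {0..1}. \<exists>\<^sub>\<infinity>N. norm (weyl_sum f x N) \<ge> real N powr \<alpha>}"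

definition strictly_convex_seq :: "(nat \<Rightarrow> int) \<Rightarrow> bool" where
  "strictly_convex_seq f \<longleftrightarrow> (\<forall>n\<ge>2. f n - f (n - 1) < f (n + 1) - f n)"

definition U1 :: "real \<Rightarrow> real \<Rightarrow> real" where
  "U1 \<tau> \<alpha> = (\<tau> + 45/13 - 5 * \<alpha>) / (\<tau> + 1 - \<alpha>)"

definition U2 :: "real \<Rightarrow> real \<Rightarrow> real" where
  "U2 \<tau> \<alpha> = (INF k \<in> {3::nat..}.
     (\<tau> - \<alpha> + 2 * real k - 1 + 2 powr (- real k + 1) - 2 * real k * \<alpha>) / (\<tau> + 1 - \<alpha>))"

end

theory Submission
  imports Defs
begin

text \<open>
  On a dyadic scale \<open>N \<approx> 2\<^sup>m\<close> a large Weyl sum forces one of its dyadic blocks to be large, and the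
  blocks vary slowly on intervals of length about \<open>N\<close> to the power \<open>\<alpha> - \<tau> - 1\<close>.  The number of such
  intervals meeting the large values is controlled by a \<open>2 k\<close>-th moment, i.e. by the additive
  energy of a convex sequence, and the resulting covers bound the Hausdorff dimension.

  The energies rest on one elementary fact: in a convex sequence \<open>a\<close>, the gap \<open>a (n + h) - a n\<close>
  and \<open>h\<close> determine \<open>n\<close>.  Applied to neighbouring representations \<open>x = a n + b\<close>, it
  replaces the Szemeredi--Trotter theorem and gives \<open>E(A, w) \<lless> |A| \<parallel>w\<parallel>\<^sub>1 \<parallel>w\<parallel>\<^sub>2\<close> as well as
  \<open>E\<^sub>3(A) \<lless> |A|\<^sup>3 log |A|\<close>.  Iterating the first bound yields the exponents \<open>2 k - 2 + 2 powr (1 - k)\<close>.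
  The exponent \<open>32/13\<close> for the ordinary energy follows Shkredov: with \<open>P\<close> a popular set of differences,
  the number of triples in \<open>A\<close> with two differences in \<open>P\<close>, weighted by the multiplicity of the third,
  is bounded from below by positive semidefiniteness and from above through \<open>E\<^sub>3(A)\<close> and \<open>E(A, P)\<close>.
\<close>


section \<open>Representations by convex sequences\<close>

text \<open>Put \<open>d = \<tau> + 1 - \<alpha>\<close>, so that intervals have length about
  \<open>N\<close> to the power \<open>- d\<close>, and let the \<open>2 k\<close>-th moment be at
  most about \<open>N\<close> to the power \<open>t\<close>. Chebyshev's inequality leaves about
  \<open>N\<close> to the power \<open>d + t - 2 k \<alpha>\<close> intervals, hence the dimension
  bound \<open>(d + t - 2 k \<alpha>) / d\<close>. The pair \<open>k = 2\<close>,
  \<open>t = 32/13\<close> gives \<open>U1\<close>; \<open>t = 2 k - 2 + 2 powr (1 - k)\<close>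
  gives the terms of \<open>U2\<close>. Two obstacles shape the argument. The lengths
  \<open>N\<close> with a large sum depend on \<open>x\<close>, so one cover must serve a whole
  dyadic range of \<open>N\<close>. Passing to dyadic blocks costs only a factor \<open>m\<close>,
  but it needs moment constants uniform over all convex sequences, since every block is a new convex
  sequence. Moreover, the dimension is an infimum over positive exponents, so the quotients above
  must be shown to be nonnegative. This follows from \<open>\<tau> \<ge> 2\<close>, which the
  quadratic growth of strictly convex integer sequences forces.\<close>

definition convex_increasing :: "(nat \<Rightarrow> int) \<Rightarrow> bool" where
  "convex_increasing a \<longleftrightarrow> strict_mono a \<and> strict_mono (\<lambda>n. a (Suc n) - a n)"

lemma convex_increasing_inj: "convex_increasing a \<Longrightarrow> inj a"
  unfolding convex_increasing_def by (simp add: strict_mono_imp_inj_on)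

lemma convex_increasing_gap_strict_mono:
  assumes "convex_increasing a" "h > 0"
  shows "strict_mono (\<lambda>n. a (n + h) - a n)"
proof -
  have "a (n + h) - a n < a (Suc n + h) - a (Suc n)" for n
  proof -
    have "a (Suc n) - a n < a (Suc (n + h)) - a (n + h)"
      using assms strict_monoD[of "\<lambda>n. a (Suc n) - a n" n "n + h"]
      unfolding convex_increasing_def by simp
    then show ?thesis by simp
  qed
  then show ?thesis by (simp add: strict_mono_Suc_iff)
qed

lemma convex_increasing_shift:
  "convex_increasing a \<Longrightarrow> convex_increasing (\<lambda>n. a (c + n))"
  unfolding convex_increasing_def strict_mono_Suc_iff by (metis add_Suc_right)

definition convolve :: "int set \<Rightarrow> (int \<Rightarrow> real) \<Rightarrow> int \<Rightarrow> real" where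
  "convolve A w x = (\<Sum>y\<in>A. w (x - y))"

lemma convolve_image:
  assumes "inj a"
  shows "convolve (a ` {..<N}) w x = (\<Sum>n<N. w (x - a n))"
  unfolding convolve_def using assms by (simp add: sum.reindex inj_on_subset)

text \<open>
  For a fixed \<open>x\<close>, moving along the representations \<open>x = a n + b\<close> with increasing \<open>n\<close>
  makes \<open>b\<close> decrease, so the representations form a monotone staircase.  If the indices are cut
  into blocks of length \<open>H\<close> and the \<open>b\<close>'s into blocks by a monotone \<open>\<beta>\<close>, the staircase meets
  only about (number of blocks) + (number of blocks) cells, labelled by
  \<open>n div H + K - \<beta> b\<close>.
\<close>

definition same_cell :: "(nat \<Rightarrow> int) \<Rightarrow> nat \<Rightarrow> (int \<Rightarrow> nat) \<Rightarrow> int \<Rightarrow> nat \<Rightarrow> nat \<Rightarrow> bool" where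
  "same_cell a H \<beta> x n m \<longleftrightarrow> n div H = m div H \<and> \<beta> (x - a n) = \<beta> (x - a m)"

text \<open>Both summands of the label are nondecreasing in \<open>n\<close>, because
  \<open>x - a n\<close> decreases. A sum of two monotone quantities can repeat only if each of them
  repeats. The bound \<open>K\<close> keeps the subtraction of naturals from truncating.\<close>

lemma staircase_label_eq_imp_same_cell:
  assumes a: "strict_mono a" and \<beta>: "mono \<beta>" and K: "\<And>b. \<beta> b \<le> K"
    and eq: "n div H + (K - \<beta> (x - a n)) = m div H + (K - \<beta> (x - a m))"
  shows "same_cell a H \<beta> x n m"
proof -
  have *: "same_cell a H \<beta> x n m"
    if "n \<le> m" and eq: "n div H + (K - \<beta> (x - a n)) = m div H + (K - \<beta> (x - a m))" for n m
  proof -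
    have "n div H \<le> m div H" using \<open>n \<le> m\<close> by (rule div_le_mono)
    moreover have "a n \<le> a m"
      using a \<open>n \<le> m\<close> by (simp add: strict_mono_less_eq)
    then have "\<beta> (x - a m) \<le> \<beta> (x - a n)" using \<beta> by (simp add: monoD)
    ultimately show ?thesis using eq K[of "x - a n"] K[of "x - a m"]
      unfolding same_cell_def by linarith
  qed
  show ?thesis
  proof (cases "n \<le> m")
    case True then show ?thesis using * eq by blast
  next
    case False
    then show ?thesis using *[of m n] eq unfolding same_cell_def by simp
  qed
qed

text \<open>Cauchy-Schwarz over the labels. The staircase makes the cost the sum of the two block
  counts, where an arbitrary set of cells would cost their product.\<close>

lemma convolve_square_le_cells:
  assumes a: "strict_mono a" and \<beta>: "mono \<beta>" and K: "\<And>b. \<beta> b \<le> K" and w: "\<And>b. w b \<ge> (0::real)"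
  shows "(\<Sum>n<N. w (x - a n))\<^sup>2 \<le> real (N div H + K + 1) *
    (\<Sum>n<N. \<Sum>m | m < N \<and> same_cell a H \<beta> x n m. w (x - a n) * w (x - a m))"
proof -
  define u where "u n = n div H + (K - \<beta> (x - a n))" for n
  define v where "v n = w (x - a n)" for n
  let ?U = "{..N div H + K}"
  have uU: "u ` {..<N} \<subseteq> ?U"
  proof
    fix y assume "y \<in> u ` {..<N}"
    then obtain n where n: "n < N" "y = u n" by blast
    have "n div H \<le> N div H" using n by (simp add: div_le_mono)
    then show "y \<in> ?U" using n unfolding u_def by simp
  qed
  have "(\<Sum>n<N. v n) = (\<Sum>i\<in>?U. \<Sum>n | n \<in> {..<N} \<and> u n = i. v n)"
    using sum.group[OF _ _ uU, of v] by simp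
  then have "(\<Sum>n<N. v n)\<^sup>2 \<le> (\<Sum>i\<in>?U. (\<Sum>n | n \<in> {..<N} \<and> u n = i. v n)\<^sup>2) * card ?U"
    using sum_squared_le_sum_of_squares[of "\<lambda>i. (\<Sum>n | n \<in> {..<N} \<and> u n = i. v n)" ?U] by simp
  also have "(\<Sum>i\<in>?U. (\<Sum>n | n \<in> {..<N} \<and> u n = i. v n)\<^sup>2)
     = (\<Sum>i\<in>?U. \<Sum>n | n \<in> {..<N} \<and> u n = i. \<Sum>m | m \<in> {..<N} \<and> u m = u n. v n * v m)"
    by (intro sum.cong refl) (simp add: power2_eq_square sum_product)
  also have "\<dots> = (\<Sum>n<N. \<Sum>m | m \<in> {..<N} \<and> u m = u n. v n * v m)"
    using sum.group[OF _ _ uU, of "\<lambda>n. \<Sum>m | m \<in> {..<N} \<and> u m = u n. v n * v m"] by simp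
  also have "\<dots> \<le> (\<Sum>n<N. \<Sum>m | m < N \<and> same_cell a H \<beta> x n m. v n * v m)"
  proof (intro sum_mono sum_mono2)
    fix n
    show "{m. m \<in> {..<N} \<and> u m = u n} \<subseteq> {m. m < N \<and> same_cell a H \<beta> x n m}"
      using staircase_label_eq_imp_same_cell[OF a \<beta> K] unfolding u_def by force
  qed (auto simp: v_def w)
  finally show ?thesis unfolding v_def by (simp add: mult.commute mult_left_mono)
qed

text \<open>
  By convexity, \<open>b = x - a n\<close>, \<open>b' = x - a m\<close> and \<open>m - n \<noteq> 0\<close> determine \<open>n\<close>, \<open>m\<close> and \<open>x\<close>.
\<close>

lemma sum_off_diagonal_cells_le:
  assumes a: "convex_increasing a" and H: "H > 0" and w: "\<And>b. w b \<ge> (0::real)"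
    and B: "finite B" "\<And>b. b \<notin> B \<Longrightarrow> w b = 0" and X: "finite X"
  shows "(\<Sum>x\<in>X. \<Sum>n<N. \<Sum>m | m < N \<and> m \<noteq> n \<and> same_cell a H \<beta> x n m. w (x - a n) * w (x - a m))
    \<le> 2 * (real H - 1) * (\<Sum>b\<in>B. \<Sum>b' | b' \<in> B \<and> \<beta> b' = \<beta> b. w b * w b')"
proof -
  define T where "T = (SIGMA x:X. SIGMA n:{..<N}. {m. m < N \<and> m \<noteq> n \<and> same_cell a H \<beta> x n m})"
  define T' where "T' = {t \<in> T. case t of (x, n, m) \<Rightarrow> x - a n \<in> B \<and> x - a m \<in> B}"
  define \<phi> where "\<phi> = (\<lambda>(x, n, m). ((x - a n, x - a m), int m - int n))"
  \<comment> \<open>Indices in one block differ by at most \<open>H - 1\<close>, which leaves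
    \<open>2 * (H - 1)\<close> nonzero shifts. Since this vanishes for \<open>H = 1\<close>,
    \<open>H\<close> may later be the ceiling of a real number below 1.\<close>
  define I where "I = {- (int H - 1)..int H - 1} - {0}"
  define R where "R = (SIGMA b:B. {b'. b' \<in> B \<and> \<beta> b' = \<beta> b})"
  define F :: "(int \<times> int) \<times> int \<Rightarrow> real" where "F = (\<lambda>((b, b'), d). w b * w b')"
  have supp: "b \<in> B" if "w b \<noteq> 0" for b using B(2) that by blast
  have "finite {m. m < N \<and> m \<noteq> n \<and> same_cell a H \<beta> x n m}" for n x by simp
  then have finT: "finite T" unfolding T_def using X by auto
  have lhs: "(\<Sum>x\<in>X. \<Sum>n<N. \<Sum>m | m < N \<and> m \<noteq> n \<and> same_cell a H \<beta> x n m. w (x - a n) * w (x - a m))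
      = (\<Sum>(x, n, m)\<in>T. w (x - a n) * w (x - a m))"
    unfolding T_def by (simp add: sum.Sigma X split_def)
  also have "\<dots> = (\<Sum>(x, n, m)\<in>T'. w (x - a n) * w (x - a m))"
    by (rule sum.mono_neutral_right) (use finT supp in \<open>auto simp: T'_def\<close>)
  also have "\<dots> = (\<Sum>t\<in>T'. F (\<phi> t))"
    by (rule sum.cong) (auto simp: F_def \<phi>_def)
  also have "\<dots> = sum F (\<phi> ` T')"
  proof -
    have "inj_on \<phi> T'"
    proof (rule inj_onI)
      fix s t assume st: "s \<in> T'" "t \<in> T'" "\<phi> s = \<phi> t"
      obtain x n m where s: "s = (x, n, m)" by (metis prod_cases3)
      obtain x' n' m' where t: "t = (x', n', m')" by (metis prod_cases3)
      have ne: "n \<noteq> m" using st(1) unfolding s T'_def T_def by auto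
      have e1: "x - a n = x' - a n'" "x - a m = x' - a m'" "int m - int n = int m' - int n'"
        using st(3) unfolding s t \<phi>_def by auto
      have "n = n'"
      proof (cases "n < m")
        case True
        then obtain h where h: "m = n + h" "h > 0" using less_imp_add_positive by blast
        then have m': "m' = n' + h" using e1 by linarith
        have "a (n + h) - a n = a (n' + h) - a n'" using e1 h m' by simp
        with strict_mono_imp_inj_on[OF convex_increasing_gap_strict_mono[OF a h(2)]]
        show ?thesis by (auto dest: injD)
      next
        case False
        then obtain h where h: "n = m + h" "h > 0" using ne less_imp_add_positive
          by (metis linorder_neqE_nat)
        then have m': "n' = m' + h" using e1 by linarith
        have "a (m + h) - a m = a (m' + h) - a m'" using e1 h m' by simp
        with strict_mono_imp_inj_on[OF convex_increasing_gap_strict_mono[OF a h(2)]]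
        have "m = m'" by (auto dest: injD)
        then show ?thesis using h m' by simp
      qed
      then show "s = t" using e1 unfolding s t by simp
    qed
    then show ?thesis by (simp add: sum.reindex)
  qed
  also have "\<dots> \<le> sum F (R \<times> I)"
  proof (rule sum_mono2)
    show "finite (R \<times> I)" unfolding R_def I_def using B by auto
    show "\<phi> ` T' \<subseteq> R \<times> I"
    proof
      fix y assume "y \<in> \<phi> ` T'"
      then obtain x n m where t: "(x, n, m) \<in> T'" "y = \<phi> (x, n, m)" by auto
      then have *: "m \<noteq> n" "n div H = m div H" "\<beta> (x - a n) = \<beta> (x - a m)"
         "x - a n \<in> B" "x - a m \<in> B"
        unfolding T'_def T_def same_cell_def by auto
      have "n = n div H * H + n mod H" "m = n div H * H + m mod H" using *(2)
        by (metis div_mult_mod_eq)+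
      moreover have "n mod H < H" "m mod H < H" using H by auto
      ultimately have "\<bar>int m - int n\<bar> \<le> int H - 1" by linarith
      then show "y \<in> R \<times> I" using * unfolding t(2) \<phi>_def R_def I_def by auto
    qed
    show "\<And>b. b \<in> R \<times> I - \<phi> ` T' \<Longrightarrow> 0 \<le> F b" unfolding F_def using w by auto
  qed
  also have "\<dots> = real (card I) * (\<Sum>(b, b')\<in>R. w b * w b')"
  proof -
    have "sum F (R \<times> I) = (\<Sum>p\<in>R. \<Sum>d\<in>I. F (p, d))" by (simp add: sum.cartesian_product)
    then show ?thesis by (simp add: F_def split_def sum_distrib_left)
  qed
  also have "(\<Sum>(b, b')\<in>R. w b * w b') = (\<Sum>b\<in>B. \<Sum>b' | b' \<in> B \<and> \<beta> b' = \<beta> b. w b * w b')"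
    unfolding R_def using B by (simp add: sum.Sigma)
  also have "real (card I) = 2 * (real H - 1)"
    unfolding I_def using H by (auto simp: card_Diff_singleton of_nat_diff)
  finally show ?thesis .
qed

text \<open>Quantile cut: \<open>\<beta> b\<close> is the integer part of the mass strictly below
  \<open>b\<close>, in units of \<open>S\<close>. Within a block this mass varies by at most
  \<open>S\<close> and misses only the largest point, of weight at most
  \<open>\<mu>\<close>.\<close>

lemma ex_balanced_blocks:
  assumes B: "finite B" and w: "\<And>b. w b \<ge> (0::real)" and S: "S > 0"
    and mx: "\<And>b. w b \<le> \<mu>"
  obtains \<beta> :: "int \<Rightarrow> nat" where "mono \<beta>" "\<And>b. \<beta> b \<le> nat \<lfloor>sum w B / S\<rfloor>"
    "(\<Sum>b\<in>B. \<Sum>b' | b' \<in> B \<and> \<beta> b' = \<beta> b. w b * w b') \<le> sum w B * (S + \<mu>)"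
proof -
  define c where "c b = sum w {b' \<in> B. b' < b}" for b
  define \<beta> where "\<beta> b = nat \<lfloor>c b / S\<rfloor>" for b
  have c_mono: "c b \<le> c b'" if "b \<le> b'" for b b'
    unfolding c_def by (rule sum_mono2) (use B w that in auto)
  have c_nonneg: "c b \<ge> 0" for b unfolding c_def by (simp add: w sum_nonneg)
  have c_le: "c b \<le> sum w B" for b
    unfolding c_def by (rule sum_mono2) (use B w in auto)
  have "mono \<beta>"
    unfolding \<beta>_def by (intro monoI nat_mono floor_mono divide_right_mono c_mono) (use S in auto)
  moreover have "\<beta> b \<le> nat \<lfloor>sum w B / S\<rfloor>" for b
    unfolding \<beta>_def by (intro nat_mono floor_mono divide_right_mono c_le) (use S in auto)
  moreover have "(\<Sum>b\<in>B. \<Sum>b' | b' \<in> B \<and> \<beta> b' = \<beta> b. w b * w b') \<le> sum w B * (S + \<mu>)"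
  proof -
    have block: "sum w {b' \<in> B. \<beta> b' = k} \<le> S + \<mu>" for k
    proof (cases "{b' \<in> B. \<beta> b' = k} = {}")
      case True
      then show ?thesis using S mx[of 0] w[of 0] by (simp only: True) simp
    next
      case False
      let ?C = "{b' \<in> B. \<beta> b' = k}"
      define l where "l = Min ?C"
      define g where "g = Max ?C"
      have fin: "finite ?C" using B by simp
      have l: "l \<in> ?C" and g: "g \<in> ?C" unfolding l_def g_def using Min_in[OF fin False] Max_in[OF fin False] by auto
      have lg: "l \<le> b" "b \<le> g" if "b \<in> ?C" for b
        unfolding l_def g_def using fin that by auto
      have "sum w ?C \<le> sum w (({b' \<in> B. b' < g} - {b' \<in> B. b' < l}) \<union> {g})"
        by (rule sum_mono2) (use B w lg in force)+
      also have "\<dots> \<le> sum w ({b' \<in> B. b' < g} - {b' \<in> B. b' < l}) + w g"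
        using B by (subst sum.union_disjoint) auto
      also have "sum w ({b' \<in> B. b' < g} - {b' \<in> B. b' < l}) = c g - c l"
        unfolding c_def using lg[OF l] by (subst sum_diff) (use B in auto)
      also have "c g - c l \<le> S"
      proof -
        have "\<lfloor>c g / S\<rfloor> = \<lfloor>c l / S\<rfloor>" using l g c_nonneg S unfolding \<beta>_def
          by (metis (mono_tags, lifting) divide_nonneg_pos eq_nat_nat_iff mem_Collect_eq zero_le_floor)
        then have "c g / S - c l / S \<le> 1" by linarith
        then have "(c g - c l) / S \<le> 1" by (simp add: diff_divide_distrib)
        then show ?thesis using S by (simp add: field_simps)
      qed
      finally show ?thesis using mx[of g] by simp
    qed
    have "(\<Sum>b\<in>B. \<Sum>b' | b' \<in> B \<and> \<beta> b' = \<beta> b. w b * w b')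
        = (\<Sum>b\<in>B. w b * sum w {b' \<in> B. \<beta> b' = \<beta> b})"
      by (simp add: sum_distrib_left)
    also have "\<dots> \<le> (\<Sum>b\<in>B. w b * (S + \<mu>))"
      by (intro sum_mono mult_left_mono block w)
    finally show ?thesis by (simp add: sum_distrib_right)
  qed
  ultimately show ?thesis using that by blast
qed


text \<open>\<open>D x\<close> is the off-diagonal part, which convexity controls only after
  summation over \<open>x\<close>. The inequality is stated for each \<open>x\<close> because the
  level set bound below absorbs the diagonal term pointwise.\<close>

lemma convolve_square_sum_le_cells:
  assumes a: "convex_increasing a" and H: "H > 0" and w: "\<And>b. w b \<ge> (0::real)"
    and B: "finite B" "\<And>b. b \<notin> B \<Longrightarrow> w b = 0" and X: "finite X"
    and S: "S > 0" and mx: "\<And>b. w b \<le> \<mu>" and W: "W = sum w B"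
  obtains D where "\<And>x. (convolve (a ` {..<N}) w x)\<^sup>2
      \<le> (real N / real H + W / S + 1) * (convolve (a ` {..<N}) (\<lambda>b. (w b)\<^sup>2) x + D x)"
    "\<And>x. D x \<ge> 0" "(\<Sum>x\<in>X. D x) \<le> 2 * (real H - 1) * (W * (S + \<mu>))"
proof -
  obtain \<beta> :: "int \<Rightarrow> nat" where \<beta>: "mono \<beta>" "\<And>b. \<beta> b \<le> nat \<lfloor>sum w B / S\<rfloor>"
    "(\<Sum>b\<in>B. \<Sum>b' | b' \<in> B \<and> \<beta> b' = \<beta> b. w b * w b') \<le> sum w B * (S + \<mu>)"
    by (rule ex_balanced_blocks[of B w S \<mu>, OF B(1) w S mx]) blast
  define D where "D x = (\<Sum>n<N. \<Sum>m | m < N \<and> m \<noteq> n \<and> same_cell a H \<beta> x n m. w (x - a n) * w (x - a m))" for x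
  have inj: "inj a" and sm: "strict_mono a"
    using a convex_increasing_inj by (auto simp: convex_increasing_def)
  have "W \<ge> 0" unfolding W by (simp add: sum_nonneg w)
  then have "real (nat \<lfloor>W / S\<rfloor>) \<le> W / S" using S by simp
  moreover have "real (N div H) \<le> real N / real H" by (simp add: of_nat_div_le_of_nat)
  ultimately have K: "real (N div H + nat \<lfloor>W / S\<rfloor> + 1) \<le> real N / real H + W / S + 1" by simp
  show ?thesis
  proof
    fix x
    show D0: "D x \<ge> 0" unfolding D_def by (intro sum_nonneg mult_nonneg_nonneg w)
    have "(\<Sum>m | m < N \<and> same_cell a H \<beta> x n m. w (x - a n) * w (x - a m))
       = (w (x - a n))\<^sup>2 + (\<Sum>m | m < N \<and> m \<noteq> n \<and> same_cell a H \<beta> x n m. w (x - a n) * w (x - a m))"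
      if "n < N" for n
    proof -
      have "{m. m < N \<and> same_cell a H \<beta> x n m} = insert n {m. m < N \<and> m \<noteq> n \<and> same_cell a H \<beta> x n m}"
        using that by (auto simp: same_cell_def)
      then show ?thesis by (simp add: power2_eq_square)
    qed
    then have "(\<Sum>n<N. \<Sum>m | m < N \<and> same_cell a H \<beta> x n m. w (x - a n) * w (x - a m))
        = convolve (a ` {..<N}) (\<lambda>b. (w b)\<^sup>2) x + D x"
      unfolding D_def convolve_image[OF inj] by (simp add: sum.distrib[symmetric])
    then have "(convolve (a ` {..<N}) w x)\<^sup>2 \<le> real (N div H + nat \<lfloor>W / S\<rfloor> + 1) *
        (convolve (a ` {..<N}) (\<lambda>b. (w b)\<^sup>2) x + D x)"
      using convolve_square_le_cells[of a \<beta> _ w x N H, OF sm \<beta>(1,2) w] unfolding convolve_image[OF inj] W by simp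
    also have "\<dots> \<le> (real N / real H + W / S + 1) * (convolve (a ` {..<N}) (\<lambda>b. (w b)\<^sup>2) x + D x)"
      by (rule mult_right_mono[OF K]) (simp add: D0 convolve_def sum_nonneg)
    finally show "(convolve (a ` {..<N}) w x)\<^sup>2
      \<le> (real N / real H + W / S + 1) * (convolve (a ` {..<N}) (\<lambda>b. (w b)\<^sup>2) x + D x)" .
  next
    have "(\<Sum>x\<in>X. D x) \<le> 2 * (real H - 1) * (\<Sum>b\<in>B. \<Sum>b' | b' \<in> B \<and> \<beta> b' = \<beta> b. w b * w b')"
      unfolding D_def by (rule sum_off_diagonal_cells_le[of a H w B X, OF a H w B X])
    also have "\<dots> \<le> 2 * (real H - 1) * (W * (S + \<mu>))"
      using \<beta>(3) H unfolding W by (intro mult_left_mono) auto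
    finally show "(\<Sum>x\<in>X. D x) \<le> 2 * (real H - 1) * (W * (S + \<mu>))" .
  qed
qed

lemma sum_convolve_le:
  assumes "\<And>b. w b \<ge> (0::real)" "finite B" "\<And>b. b \<notin> B \<Longrightarrow> w b = 0" "finite X" "finite A"
  shows "(\<Sum>x\<in>X. convolve A w x) \<le> real (card A) * sum w B"
proof -
  have "(\<Sum>x\<in>X. w (x - y)) \<le> sum w B" for y
  proof -
    have "(\<Sum>x\<in>X. w (x - y)) = sum w ((\<lambda>x. x - y) ` X)"
      by (subst sum.reindex) (auto simp: inj_on_def)
    also have "\<dots> = sum w ((\<lambda>x. x - y) ` X \<inter> B)"
      using assms by (intro sum.mono_neutral_right) auto
    also have "\<dots> \<le> sum w B" using assms by (intro sum_mono2) auto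
    finally show ?thesis .
  qed
  then have "(\<Sum>y\<in>A. \<Sum>x\<in>X. w (x - y)) \<le> (\<Sum>y\<in>A. sum w B)" by (intro sum_mono)
  then show ?thesis unfolding convolve_def by (subst sum.swap) simp
qed

text \<open>Let \<open>W\<close> and \<open>v\<close> be the l1 and l2 norms of \<open>w\<close>.
  Taking \<open>S = v\<close> and \<open>H\<close> about \<open>N v / W\<close> makes both block
  counts about \<open>W / v\<close>, while the diagonal and off-diagonal parts are both at most of
  order \<open>N\<close> times \<open>v\<close> squared.\<close>

theorem convex_convolve_energy:
  assumes a: "convex_increasing a" and w: "\<And>b. w b \<ge> (0::real)"
    and B: "finite B" "\<And>b. b \<notin> B \<Longrightarrow> w b = 0" and X: "finite X"
  shows "(\<Sum>x\<in>X. (convolve (a ` {..<N}) w x)\<^sup>2) \<le> 15 * real N * sum w B * sqrt (\<Sum>b\<in>B. (w b)\<^sup>2)"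
proof -
  define W where "W = sum w B"
  define v where "v = sqrt (\<Sum>b\<in>B. (w b)\<^sup>2)"
  show ?thesis
  proof (cases "v = 0 \<or> N = 0")
    case True
    have "w b = 0" if "v = 0" for b
      using that B w unfolding v_def by (cases "b \<in> B") (auto simp: sum_nonneg_eq_0_iff)
    then have "convolve (a ` {..<N}) w x = 0" for x using True by (auto simp: convolve_def)
    then show ?thesis using True unfolding v_def by auto
  next
    case False
    have v2: "v\<^sup>2 = (\<Sum>b\<in>B. (w b)\<^sup>2)" unfolding v_def by (simp add: sum_nonneg)
    have "v \<ge> 0" unfolding v_def by (simp add: sum_nonneg)
    then have v0: "v > 0" using False by simp
    have N: "N > 0" using False by simp
    have "v\<^sup>2 \<le> W\<^sup>2"
    proof -
      have "w b \<le> W" if "b \<in> B" for b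
        unfolding W_def using that B w by (intro member_le_sum) auto
      then have "(\<Sum>b\<in>B. (w b)\<^sup>2) \<le> (\<Sum>b\<in>B. w b * W)"
        by (intro sum_mono) (simp add: power2_eq_square mult_left_mono w)
      then show ?thesis unfolding v2 by (simp add: sum_distrib_right[symmetric] W_def power2_eq_square)
    qed
    then have vW: "v \<le> W" by (rule power2_le_imp_le) (simp add: W_def sum_nonneg w)
    \<comment> \<open>This allows \<open>\<mu> = v\<close>, so that with \<open>S = v\<close> every
      block has mass at most \<open>2 v\<close>.\<close>
    have mx: "w b \<le> v" for b
    proof (cases "b \<in> B")
      case True
      then have "(w b)\<^sup>2 \<le> v\<^sup>2"
        unfolding v2 using B by (intro member_le_sum) auto
      then show ?thesis using v0 by (rule_tac power2_le_imp_le) auto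
    qed (use B v0 in auto)
    define H where "H = nat \<lceil>real N * v / W\<rceil>"
    have pos: "real N * v / W > 0" using N v0 vW by simp
    then have H: "H > 0" "real H \<ge> real N * v / W" "real H - 1 \<le> real N * v / W"
      unfolding H_def by (linarith)+
    obtain D where D: "\<And>x. (convolve (a ` {..<N}) w x)\<^sup>2
      \<le> (real N / real H + W / v + 1) * (convolve (a ` {..<N}) (\<lambda>b. (w b)\<^sup>2) x + D x)"
      "\<And>x. D x \<ge> 0" "(\<Sum>x\<in>X. D x) \<le> 2 * (real H - 1) * (W * (v + v))"
      by (rule convolve_square_sum_le_cells[of a H w B X v v W, OF a H(1) w B X v0 mx W_def]) blast+
    have K: "real N / real H + W / v + 1 \<le> 3 * W / v"
    proof -
      have "real N / real H \<le> real N / (real N * v / W)"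
        using H pos by (intro divide_left_mono mult_pos_pos) auto
      also have "\<dots> = W / v" using N by simp
      finally have "real N / real H \<le> W / v" .
      moreover have "1 \<le> W / v" using vW v0 by simp
      ultimately show ?thesis by simp
    qed
    have DS: "(\<Sum>x\<in>X. D x) \<le> 4 * real N * v\<^sup>2"
    proof -
      have "2 * (real H - 1) * (W * (v + v)) \<le> 2 * (real N * v / W) * (W * (v + v))"
        using H v0 vW by (intro mult_right_mono) auto
      also have "\<dots> = 4 * real N * v\<^sup>2" using v0 vW by (simp add: power2_eq_square field_simps)
      finally show ?thesis using D(3) by linarith
    qed
    have CS: "(\<Sum>x\<in>X. convolve (a ` {..<N}) (\<lambda>b. (w b)\<^sup>2) x) \<le> real N * v\<^sup>2"
    proof -
      have "card (a ` {..<N}) = N"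
        using convex_increasing_inj[OF a] by (simp add: card_image inj_on_subset)
      then show ?thesis
        using sum_convolve_le[of "\<lambda>b. (w b)\<^sup>2" B X "a ` {..<N}"] B X unfolding v2 by simp
    qed
    have "(\<Sum>x\<in>X. (convolve (a ` {..<N}) w x)\<^sup>2)
      \<le> (\<Sum>x\<in>X. 3 * W / v * (convolve (a ` {..<N}) (\<lambda>b. (w b)\<^sup>2) x + D x))"
    proof (rule sum_mono)
      fix x
      have "0 \<le> convolve (a ` {..<N}) (\<lambda>b. (w b)\<^sup>2) x + D x" using D(2)[of x]
        by (simp add: convolve_def sum_nonneg)
      then show "(convolve (a ` {..<N}) w x)\<^sup>2
          \<le> 3 * W / v * (convolve (a ` {..<N}) (\<lambda>b. (w b)\<^sup>2) x + D x)"
        using D(1)[of x] mult_right_mono[OF K] by fastforce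
    qed
    also have "\<dots> = 3 * W / v * ((\<Sum>x\<in>X. convolve (a ` {..<N}) (\<lambda>b. (w b)\<^sup>2) x) + (\<Sum>x\<in>X. D x))"
      by (simp only: sum_distrib_left[symmetric] sum.distrib)
    \<comment> \<open>The factor 5 is one from the diagonal and four from the off-diagonal
      part.\<close>
    also have "\<dots> \<le> 3 * W / v * (5 * real N * v\<^sup>2)"
      using DS CS v0 vW by (intro mult_left_mono) auto
    also have "\<dots> = 15 * real N * W * v" using v0 by (simp add: power2_eq_square)
    finally show ?thesis unfolding W_def v_def .
  qed
qed

section \<open>Level sets of the number of representations as a difference\<close>

definition diff_rep :: "int set \<Rightarrow> int \<Rightarrow> nat" where
  "diff_rep A d = card {y \<in> A. y - d \<in> A}"

text \<open>With the indicator of \<open>- A\<close> as weight, the convolution with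
  \<open>A\<close> is \<open>diff_rep A\<close>. Once the block count is at most
  \<open>\<Delta> / 2\<close>, the diagonal accounts for at most half of each square, so every
  \<open>d\<close> in \<open>D\<close> has off-diagonal error at least \<open>\<Delta>\<close>. The
  bound on the total error then limits \<open>card D\<close>.\<close>

theorem convex_diff_rep_level_set:
  assumes a: "convex_increasing a" and A: "A = a ` {..<N}" and D: "finite D" "\<Delta> > 0"
    and lev: "\<And>d. d \<in> D \<Longrightarrow> real (diff_rep A d) \<ge> \<Delta>"
  shows "real (card D) * \<Delta> ^ 3 \<le> 512 * real N ^ 3"
proof (cases "D = {}")
  case False
  have inj: "inj_on a {..<N}" by (rule inj_on_subset[OF convex_increasing_inj[OF a]]) simp
  have cA: "card A = N" "finite A" unfolding A using inj by (auto simp: card_image)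
  have r_le: "diff_rep A d \<le> N" for d
    unfolding diff_rep_def using cA by (metis (no_types, lifting) card_mono mem_Collect_eq subsetI)
  have \<Delta>N: "\<Delta> \<le> real N" using False lev r_le by (metis all_not_in_conv dual_order.trans of_nat_le_iff)
  define w :: "int \<Rightarrow> real" where "w b = of_bool (- b \<in> A)" for b
  define B where "B = uminus ` A"
  have cB: "card B = N" "finite B" unfolding B_def using cA by (auto simp: card_image)
  have wB: "w b = 0" if "b \<notin> B" for b using that unfolding w_def B_def
    by (auto simp: image_iff)
  have "sum w B = (\<Sum>b\<in>B. 1)" unfolding w_def B_def by (rule sum.cong) auto
  then have WB: "real N = sum w B" using cB by simp
  have w2: "(w b)\<^sup>2 = w b" for b unfolding w_def by simp
  have conv: "convolve A w d = real (diff_rep A d)" for d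
    unfolding convolve_def diff_rep_def w_def using cA by (simp add: of_bool_def sum.If_cases Int_def)
  show ?thesis
  proof (cases "\<Delta> \<ge> 4")
    case True
    have N: "real N \<ge> 4" using True \<Delta>N by simp
    \<comment> \<open>Both block counts become at most \<open>\<Delta> / 8\<close>, and the
      additional 1 is at most \<open>\<Delta> / 4\<close> because
      \<open>\<Delta> \<ge> 4\<close>.\<close>
    define S where "S = 8 * real N / \<Delta>"
    have S: "S > 0" "S \<ge> 8" using True \<Delta>N N unfolding S_def by (auto simp: field_simps)
    define H where "H = nat \<lceil>S\<rceil>"
    have H: "H > 0" "real H \<ge> S" "real H - 1 \<le> S" unfolding H_def using S by linarith+
    obtain Dx where Dx: "\<And>x. (convolve (a ` {..<N}) w x)\<^sup>2
      \<le> (real N / real H + real N / S + 1) * (convolve (a ` {..<N}) (\<lambda>b. (w b)\<^sup>2) x + Dx x)"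
      "\<And>x. Dx x \<ge> 0" "(\<Sum>x\<in>D. Dx x) \<le> 2 * (real H - 1) * (real N * (S + 1))"
      by (rule convolve_square_sum_le_cells[of a H w B D S 1 "real N", OF a H(1) _ cB(2) wB D(1) S(1) _ WB])
        (auto simp: w_def)
    have NS: "real N / S = \<Delta> / 8" unfolding S_def using N True by simp
    have "real N / real H \<le> real N / S" using H S by (intro divide_left_mono) auto
    then have K: "real N / real H + real N / S + 1 \<le> \<Delta> / 2" using NS True by linarith
    have "\<Delta> \<le> Dx x" if "x \<in> D" for x
    proof -
      define r where "r = real (diff_rep A x)"
      have r: "r \<ge> \<Delta>" using lev[OF that] unfolding r_def .
      have "r\<^sup>2 \<le> (real N / real H + real N / S + 1) * (r + Dx x)"
        using Dx(1)[of x] unfolding w2 A[symmetric] conv r_def .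
      also have "\<dots> \<le> \<Delta> / 2 * (r + Dx x)"
        using K Dx(2)[of x] r True by (intro mult_right_mono) auto
      also have "\<dots> \<le> r / 2 * (r + Dx x)"
        using r Dx(2)[of x] True by (intro mult_right_mono) auto
      finally have "r * r \<le> r * ((r + Dx x) / 2)" by (simp add: power2_eq_square)
      then have "r \<le> (r + Dx x) / 2" using r True by simp
      then show ?thesis using r by simp
    qed
    then have "real (card D) * \<Delta> \<le> (\<Sum>x\<in>D. Dx x)"
      using sum_mono[of D "\<lambda>_. \<Delta>" Dx] by simp
    also have "\<dots> \<le> 2 * (real H - 1) * (real N * (S + 1))" by (rule Dx(3))
    also have "\<dots> \<le> 2 * S * (real N * (2 * S))"
      using H S by (intro mult_mono mult_nonneg_nonneg) auto
    also have "\<dots> = 256 * real N ^ 3 / \<Delta>\<^sup>2"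
      unfolding S_def by (simp add: power2_eq_square power3_eq_cube)
    finally have "real (card D) * \<Delta> * \<Delta>\<^sup>2 \<le> 256 * real N ^ 3"
      using True by (simp add: pos_le_divide_eq)
    then have "real (card D) * \<Delta> ^ 3 \<le> 256 * real N ^ 3"
      by (simp only: power2_eq_square power3_eq_cube mult.assoc)
    moreover have "0 \<le> real N ^ 3" by simp
    ultimately show ?thesis by linarith
  next
    case False
    \<comment> \<open>For \<open>\<Delta> < 4\<close> the trivial count of all differences,
      \<open>N\<close> squared, is enough.\<close>
    have "D \<subseteq> (\<lambda>(x, y). x - y) ` (A \<times> A)"
    proof
      fix d assume "d \<in> D"
      then have "diff_rep A d > 0" using lev[of d] D by (cases "diff_rep A d") auto
      then obtain y where "y \<in> A" "y - d \<in> A" unfolding diff_rep_def card_gt_0_iff by blast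
      then show "d \<in> (\<lambda>(x, y). x - y) ` (A \<times> A)" by (auto intro!: image_eqI[of _ _ "(y, y - d)"])
    qed
    then have "card D \<le> card (A \<times> A)"
      using cA surj_card_le by (metis finite_cartesian_product)
    then have "real (card D) \<le> real N ^ 2" using cA by (simp add: power2_eq_square flip: of_nat_mult)
    moreover have "\<Delta> ^ 3 \<le> 4 ^ 3" using False D by (intro power_mono) auto
    ultimately have "real (card D) * \<Delta> ^ 3 \<le> real N ^ 2 * 64"
      using D by (intro mult_mono) auto
    moreover have "real N ^ 2 \<le> real N ^ 3" using \<Delta>N D by (cases N) (auto intro!: power_increasing)
    moreover have "0 \<le> real N ^ 3" by simp
    ultimately show ?thesis by linarith
  qed
qed auto

section \<open>Energies and popular differences\<close>

definition differences :: "int set \<Rightarrow> int set" where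
  "differences A = (\<lambda>(x, y). x - y) ` (A \<times> A)"

lemma finite_differences: "finite A \<Longrightarrow> finite (differences A)"
  unfolding differences_def by simp

lemma differencesI: "x \<in> A \<Longrightarrow> y \<in> A \<Longrightarrow> x - y \<in> differences A"
  unfolding differences_def by force

lemma diff_rep_le_card: "finite A \<Longrightarrow> diff_rep A d \<le> card A"
  unfolding diff_rep_def by (rule card_mono) auto

lemma diff_rep_pos:
  assumes "finite A" "d \<in> differences A"
  shows "diff_rep A d \<ge> 1"
proof -
  obtain x y where "x \<in> A" "y \<in> A" "d = x - y" using assms unfolding differences_def by auto
  then have "{y \<in> A. y - d \<in> A} \<noteq> {}" by force
  then show ?thesis using assms unfolding diff_rep_def
    by (simp add: Suc_le_eq card_gt_0_iff)
qed

lemma sum_over_differences: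
  fixes h :: "int \<Rightarrow> 'b::semiring_1"
  assumes A: "finite A"
  shows "(\<Sum>x\<in>A. \<Sum>y\<in>A. h (x - y)) = (\<Sum>d\<in>differences A. of_nat (diff_rep A d) * h d)"
proof -
  have c: "card {p \<in> A \<times> A. fst p - snd p = d} = diff_rep A d" for d
  proof -
    have "bij_betw (\<lambda>y. (y, y - d)) {y \<in> A. y - d \<in> A} {p \<in> A \<times> A. fst p - snd p = d}"
      by (rule bij_betwI[where g = fst]) (auto simp: algebra_simps)
    then show ?thesis unfolding diff_rep_def by (rule bij_betw_same_card[symmetric])
  qed
  have "(\<Sum>x\<in>A. \<Sum>y\<in>A. h (x - y)) = (\<Sum>p\<in>A \<times> A. h (fst p - snd p))"
    by (simp add: sum.cartesian_product split_def)
  also have "\<dots> = (\<Sum>d\<in>differences A. \<Sum>p | p \<in> A \<times> A \<and> fst p - snd p = d. h (fst p - snd p))"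
    using A differencesI by (subst sum.group) (auto simp: finite_differences)
  also have "\<dots> = (\<Sum>d\<in>differences A. \<Sum>p | p \<in> A \<times> A \<and> fst p - snd p = d. h d)"
    by (intro sum.cong refl) (simp_all)
  also have "\<dots> = (\<Sum>d\<in>differences A. of_nat (diff_rep A d) * h d)"
    using c by simp
  finally show ?thesis .
qed

definition diff_energy :: "nat \<Rightarrow> int set \<Rightarrow> real" where
  "diff_energy k A = (\<Sum>d\<in>differences A. real (diff_rep A d) ^ k)"

lemma diff_energy_nonneg: "diff_energy k A \<ge> 0"
  unfolding diff_energy_def by (simp add: sum_nonneg)

definition diff_level :: "int set \<Rightarrow> nat \<Rightarrow> int set" where
  "diff_level A j = {d \<in> differences A. 2 ^ j \<le> diff_rep A d \<and> diff_rep A d < 2 ^ (j + 1)}"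

lemma finite_diff_level: "finite A \<Longrightarrow> finite (diff_level A j)"
  unfolding diff_level_def by (simp add: finite_differences)

lemma ex_dyadic_level:
  assumes "finite A" "card A < 2 ^ L"
  obtains lv where "\<And>d. d \<in> differences A \<Longrightarrow> lv d < L"
    "\<And>d j. d \<in> differences A \<Longrightarrow> lv d = j \<longleftrightarrow> d \<in> diff_level A j"
proof -
  have "\<exists>j. 2 ^ j \<le> diff_rep A d \<and> diff_rep A d < 2 ^ (j + 1)" if "d \<in> differences A" for d
    using ex_power_ivl1[of 2 "diff_rep A d"] diff_rep_pos[OF assms(1) that] by auto
  then obtain lv where lv: "\<And>d. d \<in> differences A \<Longrightarrow>
      2 ^ lv d \<le> diff_rep A d \<and> diff_rep A d < 2 ^ (lv d + 1)"
    by metis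
  show ?thesis
  proof
    fix d assume d: "d \<in> differences A"
    have "2 ^ lv d < (2::nat) ^ L"
      using lv[OF d] diff_rep_le_card[OF assms(1), of d] assms(2) by linarith
    then show "lv d < L" by simp
    fix j
    show "lv d = j \<longleftrightarrow> d \<in> diff_level A j"
    proof
      assume "d \<in> diff_level A j"
      then have "2 ^ lv d < (2::nat) ^ (j + 1)" "2 ^ j < (2::nat) ^ (lv d + 1)"
        using lv[OF d] unfolding diff_level_def by auto
      then have "lv d < j + 1" "j < lv d + 1" by (metis one_less_numeral_iff power_strict_increasing_iff semiring_norm(76))+
      then show "lv d = j" by simp
    qed (use lv d in \<open>auto simp: diff_level_def\<close>)
  qed
qed

lemma diff_energy_le_levels:
  assumes A: "finite A" "card A < 2 ^ L"
  shows "diff_energy k A \<le> 2 ^ k * (\<Sum>j<L. real (card (diff_level A j)) * (2 ^ j) ^ k)"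
proof -
  obtain lv where lv: "\<And>d. d \<in> differences A \<Longrightarrow> lv d < L"
    "\<And>d j. d \<in> differences A \<Longrightarrow> lv d = j \<longleftrightarrow> d \<in> diff_level A j"
    using ex_dyadic_level[OF A] by blast
  have "diff_energy k A = (\<Sum>j<L. \<Sum>d | d \<in> differences A \<and> lv d = j. real (diff_rep A d) ^ k)"
    unfolding diff_energy_def
    by (rule sum.group[symmetric]) (use A lv in \<open>auto simp: finite_differences\<close>)
  also have "\<dots> \<le> (\<Sum>j<L. \<Sum>d | d \<in> differences A \<and> lv d = j. (2 * 2 ^ j) ^ k)"
  proof (intro sum_mono power_mono)
    fix j d assume "d \<in> {d \<in> differences A. lv d = j}"
    then have "diff_rep A d < 2 ^ (j + 1)" using lv(2) unfolding diff_level_def by blast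
    then have "real (diff_rep A d) < real (2 ^ (j + 1))" by (simp only: of_nat_less_iff)
    then show "real (diff_rep A d) \<le> 2 * 2 ^ j" by simp
  qed auto
  also have "\<dots> = (\<Sum>j<L. real (card (diff_level A j)) * (2 * 2 ^ j) ^ k)"
  proof (rule sum.cong)
    fix j
    have "{d \<in> differences A. lv d = j} = diff_level A j"
      using lv(2) unfolding diff_level_def by blast
    then show "(\<Sum>d | d \<in> differences A \<and> lv d = j. (2 * 2 ^ j) ^ k)
       = real (card (diff_level A j)) * (2 * 2 ^ j) ^ k" by simp
  qed simp
  finally show ?thesis by (simp add: sum_distrib_left power_mult_distrib mult_ac)
qed

lemma diff_level_card_power_le_energy:
  assumes "finite A"
  shows "real (card (diff_level A j)) * (2 ^ j) ^ k \<le> diff_energy k A"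
proof -
  have "real (card (diff_level A j)) * (2 ^ j) ^ k = (\<Sum>d\<in>diff_level A j. (2 ^ j) ^ k)" by simp
  also have "\<dots> \<le> (\<Sum>d\<in>diff_level A j. real (diff_rep A d) ^ k)"
  proof (intro sum_mono power_mono)
    fix d assume "d \<in> diff_level A j"
    then have "real (2 ^ j) \<le> real (diff_rep A d)" unfolding diff_level_def by (simp only: of_nat_le_iff) auto
    then show "2 ^ j \<le> real (diff_rep A d)" by simp
  qed auto
  also have "\<dots> \<le> diff_energy k A"
    unfolding diff_energy_def
    by (rule sum_mono2) (use assms in \<open>auto simp: diff_level_def finite_differences\<close>)
  finally show ?thesis .
qed

section \<open>Triples with two popular differences\<close>

lemma sum_squares_gram:
  fixes u :: "'a \<Rightarrow> 'b \<Rightarrow> real"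
  shows "(\<Sum>p\<in>P. \<Sum>q\<in>P. (\<Sum>x\<in>A. u x p * u x q)\<^sup>2) = (\<Sum>x\<in>A. \<Sum>y\<in>A. (\<Sum>p\<in>P. u x p * u y p)\<^sup>2)"
proof -
  have "(\<Sum>p\<in>P. \<Sum>q\<in>P. (\<Sum>x\<in>A. u x p * u x q)\<^sup>2)
     = (\<Sum>p\<in>P. \<Sum>q\<in>P. \<Sum>x\<in>A. \<Sum>y\<in>A. u x p * u y p * (u x q * u y q))"
    by (simp add: power2_eq_square sum_product mult_ac)
  also have "\<dots> = (\<Sum>p\<in>P. \<Sum>x\<in>A. \<Sum>q\<in>P. \<Sum>y\<in>A. u x p * u y p * (u x q * u y q))"
    by (intro sum.cong refl sum.swap)
  also have "\<dots> = (\<Sum>p\<in>P. \<Sum>x\<in>A. \<Sum>y\<in>A. \<Sum>q\<in>P. u x p * u y p * (u x q * u y q))"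
    by (intro sum.cong refl sum.swap)
  also have "\<dots> = (\<Sum>x\<in>A. \<Sum>p\<in>P. \<Sum>y\<in>A. \<Sum>q\<in>P. u x p * u y p * (u x q * u y q))"
    by (rule sum.swap)
  also have "\<dots> = (\<Sum>x\<in>A. \<Sum>y\<in>A. \<Sum>p\<in>P. \<Sum>q\<in>P. u x p * u y p * (u x q * u y q))"
    by (intro sum.cong refl sum.swap)
  also have "\<dots> = (\<Sum>x\<in>A. \<Sum>y\<in>A. (\<Sum>p\<in>P. u x p * u y p)\<^sup>2)"
    by (simp add: power2_eq_square sum_product mult_ac)
  finally show ?thesis .
qed

text \<open>The generalised convolution of three copies of the indicator of \<open>A\<close>; over
  all integer pairs of shifts its squares sum to the third energy.\<close>

definition triple_rep :: "int set \<Rightarrow> int \<Rightarrow> int \<Rightarrow> real" where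
  "triple_rep A \<alpha> \<beta> = (\<Sum>x\<in>A. of_bool (x + \<alpha> \<in> A) * of_bool (x + \<beta> \<in> A))"

lemma triple_rep_nonneg: "triple_rep A \<alpha> \<beta> \<ge> 0"
  unfolding triple_rep_def by (simp add: sum_nonneg)

lemma sum_pairs_le_diff_rep:
  assumes A: "finite A" and P: "finite P"
  shows "(\<Sum>\<alpha>\<in>P. of_bool (x + \<alpha> \<in> A) * of_bool (y + \<alpha> \<in> A)) \<le> real (diff_rep A (x - y))"
proof -
  have "(\<Sum>\<alpha>\<in>P. of_bool (x + \<alpha> \<in> A) * of_bool (y + \<alpha> \<in> A))
      = (\<Sum>\<alpha>\<in>P. if x + \<alpha> \<in> A \<and> y + \<alpha> \<in> A then 1 else 0 :: real)"
    by (intro sum.cong) auto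
  also have "\<dots> = real (card {\<alpha> \<in> P. x + \<alpha> \<in> A \<and> y + \<alpha> \<in> A})"
    using P by (simp add: sum.If_cases Int_def)
  also have "card {\<alpha> \<in> P. x + \<alpha> \<in> A \<and> y + \<alpha> \<in> A} \<le> card {v \<in> A. v - (x - y) \<in> A}"
    by (rule card_inj_on_le[where f = "\<lambda>\<alpha>. x + \<alpha>"]) (use A in \<open>auto simp: algebra_simps\<close>)
  finally show ?thesis unfolding diff_rep_def by simp
qed

text \<open>The two Gram matrices of one rectangular matrix have the same sum of squared entries.
  This trades pairs of shifts for pairs of points \<open>x\<close>, \<open>y\<close>, where the
  entry is at most \<open>diff_rep A (x - y)\<close>.\<close>

lemma sum_triple_rep_squares_le:
  assumes A: "finite A" and P: "finite P"
  shows "(\<Sum>\<alpha>\<in>P. \<Sum>\<beta>\<in>P. (triple_rep A \<alpha> \<beta>)\<^sup>2) \<le> diff_energy 3 A"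
proof -
  have "(\<Sum>\<alpha>\<in>P. \<Sum>\<beta>\<in>P. (triple_rep A \<alpha> \<beta>)\<^sup>2)
    = (\<Sum>x\<in>A. \<Sum>y\<in>A. (\<Sum>\<alpha>\<in>P. of_bool (x + \<alpha> \<in> A) * of_bool (y + \<alpha> \<in> A))\<^sup>2)"
    unfolding triple_rep_def by (rule sum_squares_gram)
  also have "\<dots> \<le> (\<Sum>x\<in>A. \<Sum>y\<in>A. (real (diff_rep A (x - y)))\<^sup>2)"
    by (intro sum_mono power_mono sum_pairs_le_diff_rep[OF A P]) (simp add: sum_nonneg)
  also have "\<dots> = diff_energy 3 A"
    unfolding diff_energy_def by (subst sum_over_differences[OF A]) (simp add: power3_eq_cube power2_eq_square mult.assoc)
  finally show ?thesis .
qed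

definition weighted_triples :: "int set \<Rightarrow> int set \<Rightarrow> real" where
  "weighted_triples A P = (\<Sum>\<alpha>\<in>P. \<Sum>\<beta>\<in>P. triple_rep A \<alpha> \<beta> * real (diff_rep A (\<alpha> - \<beta>)))"

text \<open>
  The matrix \<open>R = (diff_rep A (y - z))\<close> indexed by \<open>A\<close> is positive semidefinite.  With \<open>M\<close> the
  0-1 matrix of \<open>y - x \<in> P\<close>, the left-hand sum of squares is the trace of \<open>M\<^sup>T R M\<close>, which is
  at least its quadratic form on the normalised all-ones vector.
\<close>

lemma weighted_triples_ge_sum_squares:
  assumes A: "finite A" and P: "finite P" and W: "finite W"
  shows "(\<Sum>x\<in>A. \<Sum>w\<in>W. (\<Sum>y\<in>A. of_bool (y - x \<in> P) * of_bool (y - w \<in> A))\<^sup>2) \<le> weighted_triples A P"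
proof -
  have re: "(\<Sum>y\<in>A. of_bool (y - x \<in> P) * of_bool (y - w \<in> A)) =
      (\<Sum>\<alpha>\<in>P. of_bool (x + \<alpha> \<in> A) * of_bool (x + \<alpha> - w \<in> A) :: real)" for x w
  proof -
    have "(\<Sum>y\<in>A. of_bool (y - x \<in> P) * of_bool (y - w \<in> A)) = (\<Sum>y | y \<in> A \<and> y - x \<in> P. of_bool (y - w \<in> A) :: real)"
      using A by (intro sum.mono_neutral_cong_right) auto
    also have "\<dots> = (\<Sum>\<alpha> | \<alpha> \<in> P \<and> x + \<alpha> \<in> A. of_bool (x + \<alpha> - w \<in> A))"
      by (rule sum.reindex_bij_witness[where i = "\<lambda>\<alpha>. x + \<alpha>" and j = "\<lambda>y. y - x"]) auto
    also have "\<dots> = (\<Sum>\<alpha>\<in>P. of_bool (x + \<alpha> \<in> A) * of_bool (x + \<alpha> - w \<in> A))"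
      using P by (intro sum.mono_neutral_cong_left) auto
    finally show ?thesis .
  qed
  have "(\<Sum>x\<in>A. \<Sum>w\<in>W. (\<Sum>y\<in>A. of_bool (y - x \<in> P) * of_bool (y - w \<in> A))\<^sup>2)
     = (\<Sum>x\<in>A. \<Sum>w\<in>W. \<Sum>\<alpha>\<in>P. \<Sum>\<beta>\<in>P. of_bool (x + \<alpha> \<in> A) * of_bool (x + \<beta> \<in> A) *
          (of_bool (x + \<alpha> - w \<in> A) * of_bool (x + \<beta> - w \<in> A)) :: real)"
    unfolding re by (simp add: power2_eq_square sum_product mult_ac)
  also have "\<dots> = (\<Sum>x\<in>A. \<Sum>\<alpha>\<in>P. \<Sum>w\<in>W. \<Sum>\<beta>\<in>P. of_bool (x + \<alpha> \<in> A) * of_bool (x + \<beta> \<in> A) *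
          (of_bool (x + \<alpha> - w \<in> A) * of_bool (x + \<beta> - w \<in> A)))"
    by (intro sum.cong refl sum.swap)
  also have "\<dots> = (\<Sum>x\<in>A. \<Sum>\<alpha>\<in>P. \<Sum>\<beta>\<in>P. \<Sum>w\<in>W. of_bool (x + \<alpha> \<in> A) * of_bool (x + \<beta> \<in> A) *
          (of_bool (x + \<alpha> - w \<in> A) * of_bool (x + \<beta> - w \<in> A)))"
    by (intro sum.cong refl sum.swap)
  also have "\<dots> = (\<Sum>x\<in>A. \<Sum>\<alpha>\<in>P. \<Sum>\<beta>\<in>P. of_bool (x + \<alpha> \<in> A) * of_bool (x + \<beta> \<in> A) *
          (\<Sum>w\<in>uminus ` W. of_bool (x + \<alpha> + w \<in> A) * of_bool (x + \<beta> + w \<in> A)))"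
    by (simp add: sum_distrib_left sum.reindex)
  also have "\<dots> \<le> (\<Sum>x\<in>A. \<Sum>\<alpha>\<in>P. \<Sum>\<beta>\<in>P. of_bool (x + \<alpha> \<in> A) * of_bool (x + \<beta> \<in> A) * real (diff_rep A (\<alpha> - \<beta>)))"
  proof (intro sum_mono mult_left_mono)
    fix x \<alpha> \<beta>
    show "(\<Sum>w\<in>uminus ` W. of_bool (x + \<alpha> + w \<in> A) * of_bool (x + \<beta> + w \<in> A)) \<le> real (diff_rep A (\<alpha> - \<beta>))"
      using sum_pairs_le_diff_rep[OF A, of "uminus ` W" "x + \<alpha>" "x + \<beta>"] W by simp
  qed auto
  also have "\<dots> = (\<Sum>\<alpha>\<in>P. \<Sum>x\<in>A. \<Sum>\<beta>\<in>P. of_bool (x + \<alpha> \<in> A) * of_bool (x + \<beta> \<in> A) * real (diff_rep A (\<alpha> - \<beta>)))"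
    by (rule sum.swap)
  also have "\<dots> = (\<Sum>\<alpha>\<in>P. \<Sum>\<beta>\<in>P. \<Sum>x\<in>A. of_bool (x + \<alpha> \<in> A) * of_bool (x + \<beta> \<in> A) * real (diff_rep A (\<alpha> - \<beta>)))"
    by (intro sum.cong refl sum.swap)
  also have "\<dots> = weighted_triples A P"
    unfolding weighted_triples_def triple_rep_def by (simp add: sum_distrib_right)
  finally show ?thesis .
qed

text \<open>Let \<open>g y\<close> count the \<open>x\<close> in \<open>A\<close> with
  \<open>y - x\<close> in \<open>P\<close>. Each such \<open>x\<close> gives a difference with at
  least \<open>\<Delta>\<close> representations, so the pairing of \<open>F\<close> with
  \<open>diff_rep A\<close> is at least \<open>\<Delta>\<close> times the sum of the squares of
  \<open>g\<close>. That sum is bounded below through the total of \<open>g\<close>, which is at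
  least \<open>card P\<close> times \<open>\<Delta>\<close>; Cauchy-Schwarz bounds the pairing above
  by the energy and the squares of \<open>F\<close>, and these by
  \<open>weighted_triples\<close>.\<close>

lemma weighted_triples_lower_bound:
  assumes A: "finite A" and P: "P \<subseteq> differences A" and \<Delta>: "\<Delta> \<ge> 0"
    and lev: "\<And>d. d \<in> P \<Longrightarrow> \<Delta> \<le> real (diff_rep A d)"
  shows "\<Delta> ^ 6 * real (card P) ^ 4 \<le> real (card A) ^ 3 * diff_energy 2 A * weighted_triples A P"
proof -
  define N where "N = real (card A)"
  define W where "W = differences A"
  define r where "r d = real (diff_rep A d)" for d
  have finW: "finite W" unfolding W_def using A by (rule finite_differences)
  have finP: "finite P" using P finW unfolding W_def by (rule finite_subset)
  define c :: "int \<Rightarrow> int \<Rightarrow> real" where "c x w = (\<Sum>y\<in>A. of_bool (y - x \<in> P) * of_bool (y - w \<in> A))" for x w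
  define g :: "int \<Rightarrow> real" where "g y = (\<Sum>x\<in>A. of_bool (y - x \<in> P))" for y
  define F where "F w = (\<Sum>x\<in>A. c x w)" for w
  have F: "F w = (\<Sum>y\<in>A. g y * of_bool (y - w \<in> A))" for w
    unfolding F_def c_def g_def by (subst sum.swap) (simp add: sum_distrib_right)
  have "(\<Sum>w\<in>W. (F w)\<^sup>2) \<le> (\<Sum>w\<in>W. (\<Sum>x\<in>A. (c x w)\<^sup>2) * N)"
    unfolding F_def N_def by (intro sum_mono sum_squared_le_sum_of_squares)
  also have "\<dots> = N * (\<Sum>x\<in>A. \<Sum>w\<in>W. (c x w)\<^sup>2)"
    by (subst sum.swap) (simp add: sum_distrib_left mult_ac)
  also have "\<dots> \<le> N * weighted_triples A P"
    unfolding c_def by (intro mult_left_mono weighted_triples_ge_sum_squares A finP finW) (simp add: N_def)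
  finally have F2: "(\<Sum>w\<in>W. (F w)\<^sup>2) \<le> N * weighted_triples A P" .
  have "(\<Sum>w\<in>W. F w * r w) = (\<Sum>w\<in>W. \<Sum>y\<in>A. g y * (of_bool (y - w \<in> A) * r w))"
    unfolding F by (simp add: sum_distrib_left sum_distrib_right mult_ac)
  also have "\<dots> = (\<Sum>y\<in>A. g y * (\<Sum>w\<in>W. of_bool (y - w \<in> A) * r w))"
    by (subst sum.swap) (simp add: sum_distrib_left)
  also have "\<dots> \<ge> (\<Sum>y\<in>A. g y * (\<Delta> * g y))"
  proof (intro sum_mono mult_left_mono)
    fix y assume y: "y \<in> A"
    have "\<Delta> * g y = (\<Sum>v\<in>A. of_bool (y - v \<in> P) * \<Delta>)"
      unfolding g_def by (simp add: sum_distrib_left mult.commute)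
    also have "\<dots> \<le> (\<Sum>v\<in>A. r (y - v))"
      unfolding r_def using lev by (intro sum_mono) (auto simp: of_bool_def)
    also have "\<dots> = (\<Sum>w | w \<in> W \<and> y - w \<in> A. r w)"
      by (rule sum.reindex_bij_witness[where i = "\<lambda>w. y - w" and j = "\<lambda>v. y - v"])
        (use y in \<open>auto simp: W_def differencesI\<close>)
    also have "\<dots> = (\<Sum>w\<in>W. of_bool (y - w \<in> A) * r w)"
      using finW by (intro sum.mono_neutral_cong_left) auto
    finally show "\<Delta> * g y \<le> (\<Sum>w\<in>W. of_bool (y - w \<in> A) * r w)" .
  qed (simp add: g_def sum_nonneg)
  finally have FG: "\<Delta> * (\<Sum>y\<in>A. (g y)\<^sup>2) \<le> (\<Sum>w\<in>W. F w * r w)"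
    by (simp add: sum_distrib_left power2_eq_square mult_ac)
  have "(\<Sum>y\<in>A. g y) = (\<Sum>d\<in>W. r d * of_bool (d \<in> P))"
    unfolding g_def W_def r_def by (rule sum_over_differences[OF A])
  also have "\<dots> = (\<Sum>d\<in>P. r d)"
    using finW P unfolding W_def by (intro sum.mono_neutral_cong_right) auto
  also have "\<dots> \<ge> (\<Sum>d\<in>P. \<Delta>)" unfolding r_def using lev by (intro sum_mono)
  finally have g1: "real (card P) * \<Delta> \<le> (\<Sum>y\<in>A. g y)" by simp
  have "(real (card P) * \<Delta>)\<^sup>2 \<le> (\<Sum>y\<in>A. g y)\<^sup>2" by (rule power_mono[OF g1]) (simp add: \<Delta>)
  also have "\<dots> \<le> (\<Sum>y\<in>A. (g y)\<^sup>2) * N" unfolding N_def by (rule sum_squared_le_sum_of_squares)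
  finally have "\<Delta> * (real (card P) * \<Delta>)\<^sup>2 \<le> \<Delta> * ((\<Sum>y\<in>A. (g y)\<^sup>2) * N)"
    using \<Delta> by (rule mult_left_mono)
  also have "\<dots> \<le> (\<Sum>w\<in>W. F w * r w) * N"
    using mult_right_mono[OF FG, of N] by (simp add: N_def mult_ac)
  finally have "(\<Delta> * (real (card P) * \<Delta>)\<^sup>2)\<^sup>2 \<le> ((\<Sum>w\<in>W. F w * r w) * N)\<^sup>2"
    by (rule power_mono) (simp add: \<Delta>)
  also have "\<dots> = (\<Sum>w\<in>W. F w * r w)\<^sup>2 * N\<^sup>2" by (simp add: power_mult_distrib)
  also have "\<dots> \<le> ((\<Sum>w\<in>W. (F w)\<^sup>2) * (\<Sum>w\<in>W. (r w)\<^sup>2)) * N\<^sup>2"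
    by (intro mult_right_mono Cauchy_Schwarz_ineq_sum) simp
  also have "\<dots> \<le> ((N * weighted_triples A P) * diff_energy 2 A) * N\<^sup>2"
    unfolding diff_energy_def r_def W_def[symmetric]
    by (intro mult_right_mono F2) (auto simp: sum_nonneg)
  finally have "(\<Delta> * (real (card P) * \<Delta>)\<^sup>2)\<^sup>2 \<le> ((N * weighted_triples A P) * diff_energy 2 A) * N\<^sup>2" .
  moreover have "(\<Delta> * (real (card P) * \<Delta>)\<^sup>2)\<^sup>2 = \<Delta> ^ 6 * real (card P) ^ 4"
    by (simp add: power_mult_distrib flip: power_mult power_add)
  moreover have "((N * weighted_triples A P) * diff_energy 2 A) * N\<^sup>2 = N ^ 3 * diff_energy 2 A * weighted_triples A P"
    by (simp add: power2_eq_square power3_eq_cube)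
  ultimately show ?thesis unfolding N_def by simp
qed

lemma convolve_of_bool:
  "finite A \<Longrightarrow> convolve A (\<lambda>b. of_bool (b \<in> B)) x = real (card {y \<in> A. x - y \<in> B})"
  unfolding convolve_def by (simp add: of_bool_def sum.If_cases Int_def)

text \<open>Each counted pair carries at least \<open>\<Delta>\<close> representations
  \<open>\<alpha> = y - z\<close> in \<open>A\<close>. Together they inject into the solutions of
  \<open>x = y - q = z + \<beta>\<close> with \<open>q\<close> in \<open>Q\<close> and
  \<open>\<beta>\<close> in \<open>P\<close>, whose number Cauchy-Schwarz bounds by the energies of
  \<open>A\<close> with \<open>- Q\<close> and with \<open>P\<close>.\<close>

lemma popular_difference_pairs_le:
  assumes A: "finite A" and P: "finite P" and Q: "finite Q" and \<Delta>: "\<Delta> \<ge> 0" and K: "K \<ge> 0"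
    and lev: "\<And>d. d \<in> P \<Longrightarrow> \<Delta> \<le> real (diff_rep A d)"
    and en: "\<And>B X. finite B \<Longrightarrow> finite X \<Longrightarrow> (\<Sum>x\<in>X. (convolve A (\<lambda>b. of_bool (b \<in> B)) x)\<^sup>2)
        \<le> K * real (card A) * (real (card B) * sqrt (real (card B)))"
  shows "(\<Delta> * real (card {(\<alpha>, \<beta>) \<in> P \<times> P. \<alpha> - \<beta> \<in> Q})) ^ 4
    \<le> K ^ 4 * real (card A) ^ 4 * real (card P) ^ 3 * real (card Q) ^ 3"
proof -
  define Z where "Z = {(\<alpha>, \<beta>) \<in> P \<times> P. \<alpha> - \<beta> \<in> Q}"
  have finZ: "finite Z" unfolding Z_def by (rule finite_subset[of _ "P \<times> P"]) (use P in auto)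
  define S where "S = (SIGMA z:Z. {y \<in> A. y - fst z \<in> A})"
  \<comment> \<open>The coordinates are \<open>x\<close>, \<open>y\<close>, \<open>z\<close> with
    \<open>x - y = - (\<alpha> - \<beta>)\<close> and \<open>x - z = \<beta>\<close>, so they
    determine \<open>\<alpha>\<close>, \<open>\<beta>\<close> and \<open>y\<close>.\<close>
  define \<phi> where "\<phi> = (\<lambda>((\<alpha>, \<beta>), y). (y - (\<alpha> - \<beta>), y, y - \<alpha>) :: int \<times> int \<times> int)"
  have finS: "finite S" unfolding S_def using finZ A by auto
  define X where "X = fst ` \<phi> ` S"
  have finX: "finite X" unfolding X_def using finS by simp
  define u where "u x = convolve A (\<lambda>b. of_bool (b \<in> uminus ` Q)) x" for x
  define v where "v x = convolve A (\<lambda>b. of_bool (b \<in> P)) x" for x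
  have "real (card Z) * \<Delta> = (\<Sum>z\<in>Z. \<Delta>)" by simp
  also have "\<dots> \<le> (\<Sum>z\<in>Z. real (diff_rep A (fst z)))"
    by (intro sum_mono lev) (auto simp: Z_def)
  also have "\<dots> = real (card S)"
    unfolding S_def diff_rep_def using finZ A by simp
  also have "card S = card (\<phi> ` S)"
    by (rule card_image[symmetric]) (auto simp: inj_on_def \<phi>_def)
  also have "\<dots> \<le> card (SIGMA x:X. {y \<in> A. x - y \<in> uminus ` Q} \<times> {z \<in> A. x - z \<in> P})"
  proof (rule card_mono)
    show "finite (SIGMA x:X. {y \<in> A. x - y \<in> uminus ` Q} \<times> {z \<in> A. x - z \<in> P})"
      using finX A by auto
    show "\<phi> ` S \<subseteq> (SIGMA x:X. {y \<in> A. x - y \<in> uminus ` Q} \<times> {z \<in> A. x - z \<in> P})"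
    proof
      fix t assume t: "t \<in> \<phi> ` S"
      then have "fst t \<in> X" unfolding X_def by blast
      moreover obtain \<alpha> \<beta> y where "((\<alpha>, \<beta>), y) \<in> S" "t = \<phi> ((\<alpha>, \<beta>), y)" using t by auto
      ultimately show "t \<in> (SIGMA x:X. {y \<in> A. x - y \<in> uminus ` Q} \<times> {z \<in> A. x - z \<in> P})"
        unfolding S_def Z_def \<phi>_def by (auto simp: image_iff intro!: bexI[of _ "\<alpha> - \<beta>"])
    qed
  qed
  also have "real (card (SIGMA x:X. {y \<in> A. x - y \<in> uminus ` Q} \<times> {z \<in> A. x - z \<in> P}))
     = (\<Sum>x\<in>X. u x * v x)"
    unfolding u_def v_def using finX A by (simp add: convolve_of_bool card_cartesian_product)
  finally have 1: "\<Delta> * real (card Z) \<le> (\<Sum>x\<in>X. u x * v x)" by (simp add: mult.commute)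
  have cQ: "card (uminus ` Q) = card Q" by (simp add: card_image)
  have "(\<Delta> * real (card Z)) ^ 2 \<le> (\<Sum>x\<in>X. u x * v x)\<^sup>2"
    by (rule power_mono[OF 1]) (simp add: \<Delta>)
  also have "\<dots> \<le> (\<Sum>x\<in>X. (u x)\<^sup>2) * (\<Sum>x\<in>X. (v x)\<^sup>2)" by (rule Cauchy_Schwarz_ineq_sum)
  also have "\<dots> \<le> (K * real (card A) * (real (card Q) * sqrt (real (card Q)))) *
      (K * real (card A) * (real (card P) * sqrt (real (card P))))"
    using en[of "uminus ` Q" X] en[of P X] P Q finX K unfolding u_def v_def cQ
    by (intro mult_mono) (auto simp: sum_nonneg)
  finally have "((\<Delta> * real (card Z)) ^ 2) ^ 2 \<le> ((K * real (card A) * (real (card Q) * sqrt (real (card Q)))) *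
      (K * real (card A) * (real (card P) * sqrt (real (card P))))) ^ 2"
    by (rule power_mono) simp
  also have "\<dots> = K ^ 4 * real (card A) ^ 4 * real (card P) ^ 3 * real (card Q) ^ 3"
    by (simp add: power_mult_distrib power2_eq_square[of K] power2_eq_square[of "real (card A)"])
       (simp add: power_numeral_reduce mult_ac)
  finally show ?thesis unfolding Z_def by (simp flip: power_mult)
qed

lemma power8_sum_le:
  fixes t :: "nat \<Rightarrow> real"
  assumes t: "\<And>j. j < L \<Longrightarrow> t j \<ge> 0" "\<And>j. j < L \<Longrightarrow> C * t j ^ 8 \<le> Y" and C: "C \<ge> 0"
  shows "C * (\<Sum>j<L. t j) ^ 8 \<le> real L ^ 8 * Y"
proof (cases "L = 0")
  case False
  then have "Max (t ` {..<L}) \<in> t ` {..<L}" by (intro Max_in) auto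
  then obtain j where "j < L" "t j = Max (t ` {..<L})" by auto
  then have j: "j < L" "\<And>i. i < L \<Longrightarrow> t i \<le> t j" by auto
  have "(\<Sum>i<L. t i) \<le> real L * t j" using sum_bounded_above[of "{..<L}" t "t j"] j by simp
  then have "(\<Sum>i<L. t i) ^ 8 \<le> (real L * t j) ^ 8"
    using t(1) by (intro power_mono) (auto intro!: sum_nonneg)
  then have "C * (\<Sum>i<L. t i) ^ 8 \<le> C * (real L * t j) ^ 8" using C by (rule mult_left_mono)
  also have "\<dots> = real L ^ 8 * (C * t j ^ 8)" by (simp add: power_mult_distrib)
  also have "\<dots> \<le> real L ^ 8 * Y" using t(2)[OF j(1)] by (intro mult_left_mono) auto
  finally show ?thesis .
qed simp

text \<open>Split by the dyadic size \<open>D\<close> of the multiplicity of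
  \<open>\<alpha> - \<beta>\<close>. Cauchy-Schwarz bounds the square of each part by
  \<open>4 * D ^ 2\<close> times the third energy times the number \<open>M\<close> of pairs. Since
  the bound on \<open>M\<close> is for its fourth power, the eighth power of each part
  appears.\<close>

lemma weighted_triples_upper_bound:
  assumes A: "finite A" "card A < 2 ^ L" and P: "finite P" and \<Delta>: "\<Delta> \<ge> 0" and K: "K \<ge> 0"
    and lev: "\<And>d. d \<in> P \<Longrightarrow> \<Delta> \<le> real (diff_rep A d)"
    and en: "\<And>B X. finite B \<Longrightarrow> finite X \<Longrightarrow> (\<Sum>x\<in>X. (convolve A (\<lambda>b. of_bool (b \<in> B)) x)\<^sup>2)
        \<le> K * real (card A) * (real (card B) * sqrt (real (card B)))"
  shows "\<Delta> ^ 4 * weighted_triples A P ^ 8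
    \<le> real L ^ 8 * (256 * K ^ 4 * real (card A) ^ 4 * real (card P) ^ 3 * diff_energy 3 A ^ 6 * diff_energy 2 A)"
proof -
  obtain lv where lv: "\<And>d. d \<in> differences A \<Longrightarrow> lv d < L"
    "\<And>d j. d \<in> differences A \<Longrightarrow> lv d = j \<longleftrightarrow> d \<in> diff_level A j"
    using ex_dyadic_level[OF A] by blast
  define Z where "Z = {(\<alpha>, \<beta>) \<in> P \<times> P. \<alpha> - \<beta> \<in> differences A}"
  define Zj where "Zj j = {(\<alpha>, \<beta>) \<in> P \<times> P. \<alpha> - \<beta> \<in> diff_level A j}" for j
  define c where "c = (\<lambda>(\<alpha>, \<beta>). triple_rep A \<alpha> \<beta>)"
  define r where "r = (\<lambda>(\<alpha>, \<beta>). real (diff_rep A (\<alpha> - \<beta>)))"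
  define t where "t j = (\<Sum>z\<in>Zj j. c z * r z)" for j
  have finZ: "finite Z" unfolding Z_def by (rule finite_subset[of _ "P \<times> P"]) (use P in auto)
  have finZj: "finite (Zj j)" for j unfolding Zj_def by (rule finite_subset[of _ "P \<times> P"]) (use P in auto)
  have c0: "c z \<ge> 0" for z unfolding c_def by (auto simp: triple_rep_nonneg split: prod.split)
  have r0: "r z \<ge> 0" for z unfolding r_def by (auto split: prod.split)
  have "weighted_triples A P = (\<Sum>z\<in>P \<times> P. c z * r z)"
    unfolding weighted_triples_def c_def r_def by (simp add: sum.cartesian_product split_def)
  also have "\<dots> = (\<Sum>z\<in>Z. c z * r z)"
  proof (rule sum.mono_neutral_right)
    show "\<forall>z\<in>P \<times> P - Z. c z * r z = 0"
    proof
      fix z assume z: "z \<in> P \<times> P - Z"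
      obtain \<alpha> \<beta> where ab: "z = (\<alpha>, \<beta>)" by (cases z)
      have "\<not> (x + \<alpha> \<in> A \<and> x + \<beta> \<in> A)" for x
        using z differencesI[of "x + \<alpha>" A "x + \<beta>"] unfolding ab Z_def by auto
      then have "triple_rep A \<alpha> \<beta> = 0" unfolding triple_rep_def by (intro sum.neutral) auto
      then have "c z = 0" unfolding ab c_def by simp
      then show "c z * r z = 0" by simp
    qed
  qed (use P in \<open>auto simp: Z_def\<close>)
  also have "\<dots> = (\<Sum>j<L. \<Sum>z | z \<in> Z \<and> lv (fst z - snd z) = j. c z * r z)"
    using finZ lv(1) by (subst sum.group) (auto simp: Z_def)
  also have "\<dots> = (\<Sum>j<L. t j)"
  proof (rule sum.cong)
    fix j
    have "{z. z \<in> Z \<and> lv (fst z - snd z) = j} = Zj j"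
    proof (intro set_eqI iffI)
      fix z assume "z \<in> {z. z \<in> Z \<and> lv (fst z - snd z) = j}"
      then show "z \<in> Zj j" using lv(2)[of "fst z - snd z" j] unfolding Z_def Zj_def by auto
    next
      fix z assume z: "z \<in> Zj j"
      then have "fst z - snd z \<in> differences A" unfolding Zj_def diff_level_def by auto
      then show "z \<in> {z. z \<in> Z \<and> lv (fst z - snd z) = j}" using z lv(2)[of "fst z - snd z" j]
        unfolding Z_def Zj_def by auto
    qed
    then show "(\<Sum>z | z \<in> Z \<and> lv (fst z - snd z) = j. c z * r z) = t j" unfolding t_def by simp
  qed simp
  finally have T: "weighted_triples A P = (\<Sum>j<L. t j)" .
  show ?thesis unfolding T
  proof (rule power8_sum_le)
    fix j
    show t0: "t j \<ge> 0" unfolding t_def by (intro sum_nonneg mult_nonneg_nonneg c0 r0)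
    define D :: real where "D = 2 ^ j"
    define M where "M = real (card (Zj j))"
    define q where "q = real (card (diff_level A j))"
    have D: "D > 0" unfolding D_def by simp
    have "t j \<le> (\<Sum>z\<in>Zj j. c z * (2 * D))"
      unfolding t_def
    proof (intro sum_mono mult_left_mono c0)
      fix z assume "z \<in> Zj j"
      then have "diff_rep A (fst z - snd z) < 2 ^ (j + 1)" unfolding Zj_def diff_level_def by auto
      then have "real (diff_rep A (fst z - snd z)) < real (2 ^ (j + 1))" by (simp only: of_nat_less_iff)
      then show "r z \<le> 2 * D" unfolding r_def D_def by (simp add: split_def)
    qed
    also have "\<dots> = 2 * D * (\<Sum>z\<in>Zj j. c z)" by (simp add: sum_distrib_right[symmetric])
    finally have "(t j)\<^sup>2 \<le> (2 * D * (\<Sum>z\<in>Zj j. c z))\<^sup>2" using t0 by (rule power_mono)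
    also have "\<dots> = 4 * D\<^sup>2 * (\<Sum>z\<in>Zj j. c z)\<^sup>2" by (simp add: power_mult_distrib)
    also have "(\<Sum>z\<in>Zj j. c z)\<^sup>2 \<le> (\<Sum>z\<in>Zj j. (c z)\<^sup>2) * M"
      unfolding M_def by (rule sum_squared_le_sum_of_squares)
    also have "(\<Sum>z\<in>Zj j. (c z)\<^sup>2) \<le> (\<Sum>z\<in>P \<times> P. (c z)\<^sup>2)"
      by (rule sum_mono2) (use P in \<open>auto simp: Zj_def\<close>)
    also have "\<dots> \<le> diff_energy 3 A"
      using sum_triple_rep_squares_le[OF A(1) P] unfolding c_def
      by (simp add: sum.cartesian_product split_def)
    finally have "(t j)\<^sup>2 \<le> 4 * D\<^sup>2 * (diff_energy 3 A * M)"
      by (simp add: M_def mult_left_mono mult_right_mono)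
    then have "((t j)\<^sup>2) ^ 4 \<le> (4 * D\<^sup>2 * (diff_energy 3 A * M)) ^ 4" by (rule power_mono) simp
    then have "\<Delta> ^ 4 * t j ^ 8 \<le> \<Delta> ^ 4 * (4 * D\<^sup>2 * (diff_energy 3 A * M)) ^ 4"
      by (intro mult_left_mono) (auto simp flip: power_mult)
    also have "\<dots> = 256 * D ^ 8 * diff_energy 3 A ^ 4 * (\<Delta> * M) ^ 4"
      by (simp add: power_mult_distrib flip: power_mult)
    also have "\<dots> \<le> 256 * D ^ 8 * diff_energy 3 A ^ 4 *
        (K ^ 4 * real (card A) ^ 4 * real (card P) ^ 3 * q ^ 3)"
      unfolding M_def Zj_def q_def
      by (intro mult_left_mono popular_difference_pairs_le A(1) P \<Delta> K lev en finite_diff_level)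
         (auto simp: D_def diff_energy_nonneg)
    \<comment> \<open>\<open>D ^ 8 * q ^ 3\<close> is regrouped so that the unknown level size
      \<open>q\<close> disappears into one ordinary and two third energies.\<close>
    also have "\<dots> = 256 * K ^ 4 * real (card A) ^ 4 * real (card P) ^ 3 * diff_energy 3 A ^ 4 * ((q * D ^ 2) * (q * D ^ 3) ^ 2)"
      by (simp add: power_mult_distrib) (simp add: power_numeral_reduce mult_ac)
    also have "\<dots> \<le> 256 * K ^ 4 * real (card A) ^ 4 * real (card P) ^ 3 * diff_energy 3 A ^ 4 * (diff_energy 2 A * (diff_energy 3 A) ^ 2)"
      using diff_level_card_power_le_energy[OF A(1), of j 2] diff_level_card_power_le_energy[OF A(1), of j 3]
      unfolding q_def D_def using K
      by (intro mult_left_mono mult_mono power_mono mult_nonneg_nonneg) (auto simp: diff_energy_nonneg)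
    also have "\<dots> = 256 * K ^ 4 * real (card A) ^ 4 * real (card P) ^ 3 * diff_energy 3 A ^ 6 * diff_energy 2 A"
      by (simp add: power_numeral_reduce mult_ac)
    finally show "\<Delta> ^ 4 * t j ^ 8 \<le> 256 * K ^ 4 * real (card A) ^ 4 * real (card P) ^ 3 * diff_energy 3 A ^ 6 * diff_energy 2 A" .
  qed (use \<Delta> in simp)
qed

text \<open>Pigeonholing gives one dyadic level \<open>P\<close> that carries the energy up to a
  factor \<open>4 L\<close>. Eliminating the weighted triple count between its lower and upper
  bounds leaves a relation between \<open>p\<close>, \<open>\<Delta>\<close> and the two
  energies.\<close>

theorem energy_le_third_energy:
  assumes A: "finite A" "card A < 2 ^ L" and K: "K \<ge> 0"
    and en: "\<And>B X. finite B \<Longrightarrow> finite X \<Longrightarrow> (\<Sum>x\<in>X. (convolve A (\<lambda>b. of_bool (b \<in> B)) x)\<^sup>2)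
        \<le> K * real (card A) * (real (card B) * sqrt (real (card B)))"
  shows "diff_energy 2 A ^ 26 \<le> 4 ^ 39 * K ^ 4 * real L ^ 43 * real (card A) ^ 28 * diff_energy 3 A ^ 12"
proof -
  define E where "E = diff_energy 2 A"
  define E3 where "E3 = diff_energy 3 A"
  define N where "N = real (card A)"
  have E0: "E \<ge> 0" "E3 \<ge> 0" "N \<ge> 0" unfolding E_def E3_def N_def by (auto simp: diff_energy_nonneg)
  show ?thesis
  proof (cases "E = 0")
    case True
    then show ?thesis using E0 K unfolding E_def[symmetric] E3_def[symmetric] by simp
  next
    case False
    have "\<exists>j<L. E \<le> 4 * real L * (real (card (diff_level A j)) * (2 ^ j)\<^sup>2)"
    proof (rule ccontr)
      assume "\<not> ?thesis"
      then have *: "4 * real L * (real (card (diff_level A j)) * (2 ^ j)\<^sup>2) < E" if "j < L" for j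
        using that by (meson not_le)
      have L0: "L > 0"
      proof (rule ccontr)
        assume "\<not> L > 0"
        then have "E \<le> 0" using diff_energy_le_levels[OF A, of 2] unfolding E_def by simp
        then show False using False E0 by simp
      qed
      have "real L * E \<le> real L * (2\<^sup>2 * (\<Sum>j<L. real (card (diff_level A j)) * (2 ^ j)\<^sup>2))"
        using diff_energy_le_levels[OF A, of 2] unfolding E_def by (intro mult_left_mono) auto
      also have "\<dots> = (\<Sum>j<L. 4 * real L * (real (card (diff_level A j)) * (2 ^ j)\<^sup>2))"
        by (simp add: sum_distrib_left mult_ac)
      also have "\<dots> < (\<Sum>j<L. E)" using L0 * by (intro sum_strict_mono) auto
      finally show False by simp
    qed
    then obtain j where j: "j < L" "E \<le> 4 * real L * (real (card (diff_level A j)) * (2 ^ j)\<^sup>2)" by blast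
    define P where "P = diff_level A j"
    define \<Delta> :: real where "\<Delta> = 2 ^ j"
    define p where "p = real (card P)"
    define T where "T = weighted_triples A P"
    have \<Delta>: "\<Delta> > 0" unfolding \<Delta>_def by simp
    have p0: "p \<ge> 0" unfolding p_def by simp
    have Ep: "E \<le> 4 * real L * (p * \<Delta>\<^sup>2)" using j(2) unfolding p_def P_def \<Delta>_def .
    have lev: "\<Delta> \<le> real (diff_rep A d)" if "d \<in> P" for d
    proof -
      have "2 ^ j \<le> diff_rep A d" using that unfolding P_def diff_level_def by simp
      then have "real (2 ^ j) \<le> real (diff_rep A d)" by (simp only: of_nat_le_iff)
      then show ?thesis unfolding \<Delta>_def by simp
    qed
    have finP: "finite P" unfolding P_def using A(1) by (rule finite_diff_level)
    have up: "\<Delta> ^ 4 * T ^ 8 \<le> real L ^ 8 * (256 * K ^ 4 * N ^ 4 * p ^ 3 * E3 ^ 6 * E)"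
      unfolding T_def N_def p_def E3_def E_def
      using weighted_triples_upper_bound[OF A finP _ K lev en] \<Delta> by simp
    have lo: "\<Delta> ^ 6 * p ^ 4 \<le> N ^ 3 * E * T"
      unfolding T_def N_def p_def E_def
      by (rule weighted_triples_lower_bound) (use A \<Delta> lev in \<open>auto simp: P_def diff_level_def\<close>)
    have p3: "p * \<Delta> ^ 3 \<le> E3"
      using diff_level_card_power_le_energy[OF A(1), of j 3] unfolding p_def P_def \<Delta>_def E3_def .
    have p_pos: "p > 0" using Ep False E0 p0 by (cases "p = 0") auto
    have "\<Delta> ^ 4 * (\<Delta> ^ 6 * p ^ 4) ^ 8 \<le> \<Delta> ^ 4 * (N ^ 3 * E * T) ^ 8"
      using lo p0 \<Delta> by (intro mult_left_mono power_mono) auto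
    also have "\<dots> = N ^ 24 * E ^ 8 * (\<Delta> ^ 4 * T ^ 8)" by (simp add: power_mult_distrib flip: power_mult)
    also have "\<dots> \<le> N ^ 24 * E ^ 8 * (real L ^ 8 * (256 * K ^ 4 * N ^ 4 * p ^ 3 * E3 ^ 6 * E))"
      using E0 by (intro mult_left_mono up) auto
    finally have "p ^ 3 * (\<Delta> ^ 52 * p ^ 29) \<le> p ^ 3 * (256 * K ^ 4 * real L ^ 8 * N ^ 28 * E3 ^ 6 * E ^ 9)"
      by (simp add: power_mult_distrib flip: power_mult) (simp add: power_numeral_reduce mult_ac)
    then have main: "\<Delta> ^ 52 * p ^ 29 \<le> 256 * K ^ 4 * real L ^ 8 * N ^ 28 * E3 ^ 6 * E ^ 9"
      using p_pos by simp
    \<comment> \<open>The power 35 is chosen so that, after six factors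
      \<open>p * \<Delta> ^ 3\<close> are bounded by the third energy, exactly the left side of
      \<open>main\<close> remains. Cancelling \<open>E ^ 9\<close> then leaves the 26th
      power.\<close>
    have "E ^ 9 * E ^ 26 = E ^ 35" by (simp flip: power_add)
    also have "\<dots> \<le> (4 * real L * (p * \<Delta>\<^sup>2)) ^ 35" using Ep E0 by (intro power_mono) auto
    also have "\<dots> = 4 ^ 35 * real L ^ 35 * (p * \<Delta> ^ 3) ^ 6 * (\<Delta> ^ 52 * p ^ 29)"
    proof -
      have "(p * \<Delta>\<^sup>2) ^ 35 = (p * \<Delta> ^ 3) ^ 6 * (\<Delta> ^ 52 * p ^ 29)"
      proof -
        have "(p * \<Delta>\<^sup>2) ^ 35 = p ^ (6 + 29) * \<Delta> ^ (18 + 52)"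
          by (simp add: power_mult_distrib flip: power_mult)
        also have "\<dots> = (p * \<Delta> ^ 3) ^ 6 * (\<Delta> ^ 52 * p ^ 29)"
        proof -
          have "(p * \<Delta> ^ 3) ^ 6 = p ^ 6 * \<Delta> ^ 18" by (simp add: power_mult_distrib flip: power_mult)
          then show ?thesis by (simp only: power_add mult_ac)
        qed
        finally show ?thesis .
      qed
      then show ?thesis by (simp add: power_mult_distrib)
    qed
    also have "\<dots> \<le> 4 ^ 35 * real L ^ 35 * E3 ^ 6 * (256 * K ^ 4 * real L ^ 8 * N ^ 28 * E3 ^ 6 * E ^ 9)"
      using p3 p0 \<Delta> E0 by (intro mult_mono[OF _ main] mult_left_mono power_mono mult_nonneg_nonneg) auto
    also have "\<dots> = E ^ 9 * (4 ^ 39 * K ^ 4 * real L ^ (35 + 8) * N ^ 28 * E3 ^ (6 + 6))"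
      unfolding power_add by (simp add: mult_ac)
    finally have "E ^ 26 \<le> 4 ^ 39 * K ^ 4 * real L ^ (35 + 8) * N ^ 28 * E3 ^ (6 + 6)"
      by (rule mult_left_le_imp_le) (use False E0 in simp)
    then show ?thesis unfolding E_def E3_def N_def by simp
  qed
qed

section \<open>Energy bounds for convex sequences\<close>

lemma card_convex_image: "convex_increasing a \<Longrightarrow> card (a ` {..<N}) = N"
  using inj_on_subset[OF convex_increasing_inj[of a], of "{..<N}"] by (simp add: card_image)

text \<open>Each dyadic level contributes at most a constant times \<open>N ^ 3\<close>, so only the
  number \<open>L\<close> of levels is lost.\<close>

lemma convex_third_energy:
  assumes a: "convex_increasing a" and N: "N < 2 ^ L"
  shows "diff_energy 3 (a ` {..<N}) \<le> 4096 * real L * real N ^ 3"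
proof -
  define A where "A = a ` {..<N}"
  have A: "finite A" "card A < 2 ^ L" unfolding A_def using N card_convex_image[OF a] by auto
  have "real (card (diff_level A j)) * (2 ^ j) ^ 3 \<le> 512 * real N ^ 3" for j
  proof (rule convex_diff_rep_level_set[OF a A_def finite_diff_level[OF A(1)]])
    fix d assume "d \<in> diff_level A j"
    then have "2 ^ j \<le> diff_rep A d" unfolding diff_level_def by simp
    then have "real (2 ^ j) \<le> real (diff_rep A d)" by (simp only: of_nat_le_iff)
    then show "2 ^ j \<le> real (diff_rep A d)" by simp
  qed simp
  then have "(\<Sum>j<L. real (card (diff_level A j)) * (2 ^ j) ^ 3) \<le> (\<Sum>j<L. 512 * real N ^ 3)"
    by (intro sum_mono)
  then show ?thesis using diff_energy_le_levels[OF A, of 3] unfolding A_def by simp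
qed

lemma ex_dyadic_exponent:
  assumes "N \<ge> 1" "\<delta> > 0"
  obtains L where "N < 2 ^ L" "real L \<le> (1 / (\<delta> * ln 2) + 1) * real N powr \<delta>"
proof -
  obtain n where n: "2 ^ n \<le> N" "N < 2 ^ (n + 1)" using ex_power_ivl1[of 2 N] assms by auto
  have "real (2 ^ n) \<le> real N" using n by (simp only: of_nat_le_iff)
  then have "ln (2 ^ n) \<le> ln (real N)" using assms by (subst ln_le_cancel_iff) auto
  then have "real n * ln 2 \<le> ln (real N)" by (simp add: ln_realpow)
  also have "\<dots> \<le> real N powr \<delta> / \<delta>" using assms by (intro ln_powr_bound) auto
  finally have "real n \<le> real N powr \<delta> / \<delta> / ln 2" by (subst pos_le_divide_eq) auto
  moreover have "1 \<le> real N powr \<delta>" using assms by (simp add: ge_one_powr_ge_zero)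
  ultimately have "real (n + 1) \<le> (1 / (\<delta> * ln 2) + 1) * real N powr \<delta>"
    by (simp add: algebra_simps)
  then show ?thesis using that n(2) by blast
qed

text \<open>Up to logarithms the 26th power of the energy is at most \<open>N ^ 28\<close> times the
  twelfth power of \<open>N ^ 3\<close>, and \<open>64 / 26 = 32 / 13\<close>.\<close>

theorem convex_energy_bound:
  assumes \<epsilon>: "\<epsilon> > 0"
  shows "\<exists>C\<ge>0. \<forall>a N. convex_increasing a \<longrightarrow> N \<ge> 1 \<longrightarrow>
    diff_energy 2 (a ` {..<N}) \<le> C * real N powr (32/13 + \<epsilon>)"
proof -
  \<comment> \<open>The logarithmic factor \<open>L\<close> enters with the power
    \<open>43 + 12 = 55\<close>, and the 26th root is taken at the end.\<close>
  define \<delta> where "\<delta> = 26 * \<epsilon> / 55"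
  define D where "D = 1 / (\<delta> * ln 2) + 1"
  \<comment> \<open>The maximum with 1 gives \<open>C \<le> C ^ 26\<close>, so both sides become
    26th powers.\<close>
  define C :: real where "C = max 1 (4 ^ 39 * 15 ^ 4 * D ^ 55 * 4096 ^ 12)"
  have \<delta>: "\<delta> > 0" unfolding \<delta>_def using \<epsilon> by simp
  have "diff_energy 2 (a ` {..<N}) \<le> C * real N powr (32/13 + \<epsilon>)"
    if a: "convex_increasing a" and N: "N \<ge> 1" for a N
  proof -
    define A where "A = a ` {..<N}"
    obtain L where L: "N < 2 ^ L" "real L \<le> D * real N powr \<delta>"
      using ex_dyadic_exponent[OF N \<delta>] unfolding D_def by blast
    have A: "finite A" "card A = N" unfolding A_def using card_convex_image[OF a] by auto
    have D0: "D \<ge> 0" unfolding D_def using \<delta> by simp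
    have en: "(\<Sum>x\<in>X. (convolve A (\<lambda>b. of_bool (b \<in> B)) x)\<^sup>2)
        \<le> 15 * real (card A) * (real (card B) * sqrt (real (card B)))" if "finite B" "finite X" for B X
    proof -
      have "sum (\<lambda>b. of_bool (b \<in> B)) B = real (card B)" "(\<Sum>b\<in>B. (of_bool (b \<in> B))\<^sup>2) = real (card B)"
        using that by (simp_all add: of_bool_def sum.If_cases)
      then show ?thesis
        using convex_convolve_energy[OF a, of "\<lambda>b. of_bool (b \<in> B)" B X N] that
        unfolding A(2) unfolding A_def by (simp add: mult.assoc)
    qed
    have "diff_energy 2 A ^ 26 \<le> 4 ^ 39 * 15 ^ 4 * real L ^ 43 * real N ^ 28 * diff_energy 3 A ^ 12"
      using energy_le_third_energy[OF A(1) _ _ en, of L] L(1) A(2) by simp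
    also have "\<dots> \<le> 4 ^ 39 * 15 ^ 4 * real L ^ 43 * real N ^ 28 * (4096 * real L * real N ^ 3) ^ 12"
      unfolding A_def by (intro mult_left_mono power_mono convex_third_energy[OF a L(1)]) (auto simp: diff_energy_nonneg)
    also have "\<dots> = 4 ^ 39 * 15 ^ 4 * 4096 ^ 12 * real L ^ (43 + 12) * real N ^ (28 + 36)"
    proof -
      have "(4096 * real L * real N ^ 3) ^ 12 = 4096 ^ 12 * real L ^ 12 * real N ^ 36"
        by (simp add: power_mult_distrib flip: power_mult)
      then show ?thesis by (simp only: power_add mult_ac)
    qed
    also have "\<dots> = 4 ^ 39 * 15 ^ 4 * 4096 ^ 12 * real L ^ 55 * real N ^ 64" by simp
    also have "\<dots> \<le> 4 ^ 39 * 15 ^ 4 * 4096 ^ 12 * (D * real N powr \<delta>) ^ 55 * real N ^ 64"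
      using L(2) by (intro mult_left_mono mult_right_mono power_mono) auto
    also have "\<dots> = 4 ^ 39 * 15 ^ 4 * D ^ 55 * 4096 ^ 12 * ((real N powr \<delta>) ^ 55 * real N ^ 64)"
      by (simp add: power_mult_distrib)
    also have "(real N powr \<delta>) ^ 55 * real N ^ 64 = (real N powr (32/13 + \<epsilon>)) ^ 26"
    proof -
      have "(real N powr \<delta>) ^ 55 * real N ^ 64 = real N powr (55 * \<delta>) * real N powr 64"
        using N by (simp add: powr_power powr_numeral mult.commute)
      also have "\<dots> = real N powr (26 * (32/13 + \<epsilon>))"
        unfolding powr_add[symmetric] \<delta>_def by (simp add: algebra_simps)
      also have "\<dots> = (real N powr (32/13 + \<epsilon>)) ^ 26"
        using N by (simp add: powr_power mult.commute)
      finally show ?thesis .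
    qed
    also have "4 ^ 39 * 15 ^ 4 * D ^ 55 * 4096 ^ 12 * (real N powr (32/13 + \<epsilon>)) ^ 26
       \<le> C ^ 26 * (real N powr (32/13 + \<epsilon>)) ^ 26"
    proof (rule mult_right_mono)
      have "4 ^ 39 * 15 ^ 4 * D ^ 55 * 4096 ^ 12 \<le> C" unfolding C_def by simp
      also have "C \<le> C ^ 26" unfolding C_def by (rule self_le_power) auto
      finally show "4 ^ 39 * 15 ^ 4 * D ^ 55 * 4096 ^ 12 \<le> C ^ 26" .
    qed simp
    finally have "diff_energy 2 A ^ 26 \<le> (C * real N powr (32/13 + \<epsilon>)) ^ 26"
      by (simp add: power_mult_distrib)
    moreover have "0 \<le> C * real N powr (32/13 + \<epsilon>)" unfolding C_def by simp
    ultimately show ?thesis unfolding A_def by (meson power_mono_iff diff_energy_nonneg zero_less_numeral)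
  qed
  moreover have "C \<ge> 0" unfolding C_def by simp
  ultimately show ?thesis by blast
qed

section \<open>Energies of iterated sumsets\<close>

fun sum_rep :: "int set \<Rightarrow> nat \<Rightarrow> int \<Rightarrow> real" where
  "sum_rep A 0 x = of_bool (x = 0)"
| "sum_rep A (Suc k) x = convolve A (sum_rep A k) x"

fun iterated_sumset :: "int set \<Rightarrow> nat \<Rightarrow> int set" where
  "iterated_sumset A 0 = {0}"
| "iterated_sumset A (Suc k) = (\<lambda>(x, y). x + y) ` (A \<times> iterated_sumset A k)"

lemma finite_iterated_sumset: "finite A \<Longrightarrow> finite (iterated_sumset A k)"
  by (induction k) auto

lemma sum_rep_nonneg: "sum_rep A k x \<ge> 0"
  by (induction k arbitrary: x) (auto simp: convolve_def sum_nonneg)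

lemma sum_rep_eq_0: "x \<notin> iterated_sumset A k \<Longrightarrow> sum_rep A k x = 0"
proof (induction k arbitrary: x)
  case (Suc k)
  have "sum_rep A k (x - y) = 0" if "y \<in> A" for y
    using Suc that by (intro Suc.IH) force
  then show ?case by (simp add: convolve_def)
qed auto

lemma sum_sum_rep_le:
  assumes "finite A"
  shows "sum (sum_rep A k) (iterated_sumset A k) \<le> real (card A) ^ k"
proof (induction k)
  case (Suc k)
  have "sum (sum_rep A (Suc k)) (iterated_sumset A (Suc k))
     = (\<Sum>x\<in>iterated_sumset A (Suc k). convolve A (sum_rep A k) x)" by simp
  also have "\<dots> \<le> real (card A) * sum (sum_rep A k) (iterated_sumset A k)"
    by (rule sum_convolve_le)
       (use assms finite_iterated_sumset sum_rep_nonneg sum_rep_eq_0 in \<open>blast+\<close>)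
  also have "\<dots> \<le> real (card A) * real (card A) ^ k" by (intro mult_left_mono Suc) simp
  finally show ?case by simp
qed simp

text \<open>As a weight, \<open>sum_rep A k\<close> has l1 norm at most \<open>N ^ k\<close> and
  squared l2 norm of exponent \<open>e\<close>. The weighted energy bound therefore gives the
  exponent \<open>1 + k + e / 2\<close> for \<open>Suc k\<close>; the stated exponent solves this
  recursion with value 0 at \<open>k = 0\<close>.\<close>

theorem convex_iterated_energy_bound:
  "\<exists>C\<ge>0. \<forall>a N. convex_increasing a \<longrightarrow> N \<ge> 1 \<longrightarrow>
     (\<Sum>x\<in>iterated_sumset (a ` {..<N}) k. (sum_rep (a ` {..<N}) k x)\<^sup>2)
       \<le> C * real N powr (2 * real k - 2 + 2 powr (1 - real k))"
proof (induction k)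
  case 0
  show ?case by (rule exI[of _ 1]) auto
next
  case (Suc k)
  then obtain C where C: "C \<ge> 0" "\<And>a N. convex_increasing a \<Longrightarrow> N \<ge> 1 \<Longrightarrow>
     (\<Sum>x\<in>iterated_sumset (a ` {..<N}) k. (sum_rep (a ` {..<N}) k x)\<^sup>2)
       \<le> C * real N powr (2 * real k - 2 + 2 powr (1 - real k))"
    by blast
  define e where "e = 2 * real k - 2 + 2 powr (1 - real k)"
  have "(\<Sum>x\<in>iterated_sumset (a ` {..<N}) (Suc k). (sum_rep (a ` {..<N}) (Suc k) x)\<^sup>2)
      \<le> (15 * sqrt C) * real N powr (2 * real (Suc k) - 2 + 2 powr (1 - real (Suc k)))"
    if a: "convex_increasing a" and N: "N \<ge> 1" for a N
  proof -
    define A where "A = a ` {..<N}"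
    have A: "finite A" "card A = N" unfolding A_def using card_convex_image[OF a] by auto
    have "(\<Sum>x\<in>iterated_sumset A (Suc k). (sum_rep A (Suc k) x)\<^sup>2)
       = (\<Sum>x\<in>iterated_sumset A (Suc k). (convolve A (sum_rep A k) x)\<^sup>2)" by simp
    also have "\<dots> \<le> 15 * real N * sum (sum_rep A k) (iterated_sumset A k) *
          sqrt (\<Sum>x\<in>iterated_sumset A k. (sum_rep A k x)\<^sup>2)"
      unfolding A_def by (rule convex_convolve_energy[OF a sum_rep_nonneg])
        (use sum_rep_eq_0 in \<open>auto intro: finite_iterated_sumset simp del: iterated_sumset.simps\<close>)
    also have "\<dots> \<le> 15 * real N * real N ^ k * sqrt (C * real N powr e)"
      using sum_sum_rep_le[OF A(1), of k] C(2)[OF a N] A(2) unfolding A_def e_def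
      by (intro mult_mono mult_left_mono real_sqrt_le_mono mult_nonneg_nonneg)
         (auto simp: sum_nonneg sum_rep_nonneg)
    also have "\<dots> = 15 * sqrt C * (real N powr 1 * real N powr real k * real N powr (e / 2))"
      using N by (simp add: real_sqrt_mult powr_half_sqrt[symmetric] powr_powr powr_realpow)
    also have "real N powr 1 * real N powr real k * real N powr (e / 2)
        = real N powr (2 * real (Suc k) - 2 + 2 powr (1 - real (Suc k)))"
    proof -
      have "2 powr (1 - real (Suc k)) = (2 powr (1 - real k)) / 2"
        using powr_diff[of 2 "1 - real k" 1] by (simp add: algebra_simps)
      then have "1 + real k + e / 2 = 2 * real (Suc k) - 2 + 2 powr (1 - real (Suc k))"
        unfolding e_def by (simp add: field_simps)
      then show ?thesis by (simp only: powr_add[symmetric])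
    qed
    finally show ?thesis unfolding A_def by simp
  qed
  then show ?case using C(1) by (intro exI[of _ "15 * sqrt C"]) auto
qed

section \<open>Moments of exponential sums\<close>

lemma additive_char_of_real: "additive_char (of_real t) = cis (2 * pi * t)"
  unfolding additive_char_def cis_conv_exp by (simp add: mult_ac)

lemma norm_additive_char_diff_le:
  "norm (additive_char (of_real s) - additive_char (of_real t)) \<le> 2 * pi * \<bar>s - t\<bar>"
proof -
  have "cis (2 * pi * s) - cis (2 * pi * t) = cis (2 * pi * t) * (cis (2 * pi * (s - t)) - 1)"
    by (simp add: cis_mult algebra_simps)
  then have "norm (additive_char (of_real s) - additive_char (of_real t)) = norm (cis (2 * pi * (s - t)) - 1)"
    unfolding additive_char_of_real by (simp add: norm_mult)
  also have "\<dots> = 2 * \<bar>sin (2 * pi * (s - t) / 2)\<bar>"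
    unfolding cis_conv_exp by (rule dist_exp_i_1)
  also have "\<dots> \<le> 2 * \<bar>2 * pi * (s - t) / 2\<bar>"
    by (intro mult_left_mono abs_sin_x_le_abs_x) simp
  finally show ?thesis by (simp add: abs_mult)
qed

lemma sum_additive_char_grid:
  fixes k :: int
  assumes M: "M > 0" and k: "\<bar>k\<bar> < int M"
  shows "(\<Sum>l<M. additive_char (of_real (real l / real M * of_int k))) = (if k = 0 then of_nat M else 0)"
proof (cases "k = 0")
  case True
  then show ?thesis by (simp add: additive_char_def)
next
  case False
  define z where "z = cis (2 * pi * (of_int k / real M))"
  have zl: "additive_char (of_real (real l / real M * of_int k)) = z ^ l" for l
    unfolding additive_char_of_real z_def Complex.DeMoivre by (simp add: mult_ac)
  have "z ^ M = cis (2 * pi * of_int k)" unfolding z_def Complex.DeMoivre using M by simp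
  then have zM: "z ^ M = 1" by simp
  have "z \<noteq> 1"
  proof
    assume "z = 1"
    then obtain n :: int where "2 * pi * (of_int k / real M) = of_int (2 * n) * pi"
      unfolding z_def cis_conv_exp exp_eq_1 by auto
    then have "(2 * pi) * (of_int k / real M) = (2 * pi) * of_int n" by (simp add: mult_ac)
    then have "of_int k / real M = of_int n" by (subst (asm) mult_cancel_left) simp
    then have "of_int k = of_int n * real M" using M by (simp add: field_simps)
    then have "of_int k = (of_int (n * int M) :: real)" by simp
    then have "k = n * int M" by (simp only: of_int_eq_iff)
    then show False using k False zdvd_not_zless[of "\<bar>k\<bar>" "int M"] by simp
  qed
  then have "(\<Sum>l<M. z ^ l) = 0" using zM by (simp add: geometric_sum)
  then show ?thesis using False zl by simp
qed

text \<open>The separation hypothesis keeps distinct frequencies distinct modulo \<open>M\<close>,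
  so the characters are orthogonal on the grid.\<close>

lemma discrete_parseval:
  fixes c :: "int \<Rightarrow> real"
  assumes D: "finite D" and M: "M > 0" and sep: "\<And>d d'. d \<in> D \<Longrightarrow> d' \<in> D \<Longrightarrow> \<bar>d - d'\<bar> < int M"
  shows "(\<Sum>l<M. (norm (\<Sum>d\<in>D. of_real (c d) * additive_char (of_real (real l / real M * of_int d))))\<^sup>2)
     = real M * (\<Sum>d\<in>D. (c d)\<^sup>2)"
proof -
  define e where "e l d = additive_char (of_real (real l / real M * of_int d))" for l :: nat and d :: int
  have ee: "e l d * cnj (e l d') = e l (d - d')" for l d d'
    unfolding e_def additive_char_of_real by (simp add: cis_cnj cis_mult algebra_simps diff_divide_distrib)
  have "complex_of_real (\<Sum>l<M. (norm (\<Sum>d\<in>D. of_real (c d) * e l d))\<^sup>2)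
     = (\<Sum>l<M. \<Sum>d\<in>D. \<Sum>d'\<in>D. of_real (c d) * of_real (c d') * e l (d - d'))"
    by (simp add: complex_norm_square sum_product ee[symmetric] mult_ac del: of_real_power)
  also have "\<dots> = (\<Sum>d\<in>D. \<Sum>l<M. \<Sum>d'\<in>D. of_real (c d) * of_real (c d') * e l (d - d'))"
    by (rule sum.swap)
  also have "\<dots> = (\<Sum>d\<in>D. \<Sum>d'\<in>D. \<Sum>l<M. of_real (c d) * of_real (c d') * e l (d - d'))"
    by (intro sum.cong refl sum.swap)
  also have "\<dots> = (\<Sum>d\<in>D. \<Sum>d'\<in>D. if d' = d then of_real (c d) * of_real (c d') * of_nat M else 0)"
  proof (intro sum.cong refl)
    fix d d' assume "d \<in> D" "d' \<in> D"
    then have "(\<Sum>l<M. e l (d - d')) = (if d' = d then of_nat M else 0)"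
      unfolding e_def using sum_additive_char_grid[OF M sep, of d d'] by simp
    then show "(\<Sum>l<M. of_real (c d) * of_real (c d') * e l (d - d'))
       = (if d' = d then of_real (c d) * of_real (c d') * of_nat M else 0)"
      by (simp add: sum_distrib_left[symmetric])
  qed
  also have "\<dots> = complex_of_real (real M * (\<Sum>d\<in>D. (c d)\<^sup>2))"
    using D by (simp add: sum_distrib_left power2_eq_square mult_ac)
  finally show ?thesis unfolding e_def by (simp only: of_real_eq_iff)
qed

definition exp_sum :: "(nat \<Rightarrow> int) \<Rightarrow> nat \<Rightarrow> real \<Rightarrow> complex" where
  "exp_sum a N x = (\<Sum>n<N. additive_char (of_real (x * of_int (a n))))"

lemma exp_sum_image:
  assumes "inj a"
  shows "exp_sum a N x = (\<Sum>y\<in>a ` {..<N}. additive_char (of_real (x * of_int y)))"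
  unfolding exp_sum_def by (subst sum.reindex) (use assms in \<open>auto intro: inj_on_subset\<close>)

lemma exp_sum_lipschitz:
  "norm (exp_sum a N x - exp_sum a N y) \<le> 2 * pi * (\<Sum>n<N. real_of_int \<bar>a n\<bar>) * \<bar>x - y\<bar>"
proof -
  have "norm (exp_sum a N x - exp_sum a N y)
     \<le> (\<Sum>n<N. norm (additive_char (of_real (x * of_int (a n))) - additive_char (of_real (y * of_int (a n)))))"
    unfolding exp_sum_def sum_subtractf[symmetric] by (rule norm_sum)
  also have "\<dots> \<le> (\<Sum>n<N. 2 * pi * \<bar>x * of_int (a n) - y * of_int (a n)\<bar>)"
    by (intro sum_mono norm_additive_char_diff_le)
  also have "\<dots> = (\<Sum>n<N. 2 * pi * real_of_int \<bar>a n\<bar> * \<bar>x - y\<bar>)"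
    by (intro sum.cong refl) (simp add: abs_mult flip: left_diff_distrib)
  finally show ?thesis by (simp add: sum_distrib_left sum_distrib_right)
qed

lemma exp_sum_power:
  assumes A: "finite A"
  shows "(\<Sum>y\<in>A. additive_char (of_real (x * of_int y))) ^ k
    = (\<Sum>m\<in>iterated_sumset A k. of_real (sum_rep A k m) * additive_char (of_real (x * of_int m)))"
proof (induction k)
  case 0
  show ?case by (simp add: additive_char_def)
next
  case (Suc k)
  define e where "e m = additive_char (of_real (x * of_int m))" for m :: int
  have e_add: "e y * e m = e (y + m)" for y m
    unfolding e_def additive_char_of_real cis_mult by (simp add: algebra_simps)
  have shift: "(\<Sum>m\<in>iterated_sumset A k. of_real (sum_rep A k m) * e (y + m))
     = (\<Sum>m\<in>iterated_sumset A (Suc k). of_real (sum_rep A k (m - y)) * e m)" if y: "y \<in> A" for y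
  proof -
    have "(\<Sum>m\<in>iterated_sumset A k. of_real (sum_rep A k m) * e (y + m))
      = (\<Sum>m\<in>(\<lambda>m. y + m) ` iterated_sumset A k. of_real (sum_rep A k (m - y)) * e m)"
      by (simp add: sum.reindex)
    also have "\<dots> = (\<Sum>m\<in>iterated_sumset A (Suc k). of_real (sum_rep A k (m - y)) * e m)"
    proof (rule sum.mono_neutral_left)
      show "finite (iterated_sumset A (Suc k))" using A by (rule finite_iterated_sumset)
      show "(\<lambda>m. y + m) ` iterated_sumset A k \<subseteq> iterated_sumset A (Suc k)" using y by auto
      show "\<forall>m\<in>iterated_sumset A (Suc k) - (\<lambda>m. y + m) ` iterated_sumset A k.
          of_real (sum_rep A k (m - y)) * e m = 0"
      proof
        fix m assume "m \<in> iterated_sumset A (Suc k) - (\<lambda>m. y + m) ` iterated_sumset A k"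
        then have "m - y \<notin> iterated_sumset A k"
          by (metis DiffD2 add.commute diff_add_cancel image_eqI)
        then show "of_real (sum_rep A k (m - y)) * e m = 0" by (simp add: sum_rep_eq_0)
      qed
    qed
    finally show ?thesis .
  qed
  have "(\<Sum>y\<in>A. e y) ^ Suc k = (\<Sum>y\<in>A. e y) * (\<Sum>m\<in>iterated_sumset A k. of_real (sum_rep A k m) * e m)"
    using Suc unfolding e_def by simp
  also have "\<dots> = (\<Sum>y\<in>A. \<Sum>m\<in>iterated_sumset A k. of_real (sum_rep A k m) * e (y + m))"
    by (simp add: sum_product e_add[symmetric] mult_ac)
  also have "\<dots> = (\<Sum>y\<in>A. \<Sum>m\<in>iterated_sumset A (Suc k). of_real (sum_rep A k (m - y)) * e m)"
    by (intro sum.cong refl shift)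
  also have "\<dots> = (\<Sum>m\<in>iterated_sumset A (Suc k). \<Sum>y\<in>A. of_real (sum_rep A k (m - y)) * e m)"
    by (rule sum.swap)
  also have "\<dots> = (\<Sum>m\<in>iterated_sumset A (Suc k). of_real (sum_rep A (Suc k) m) * e m)"
    by (simp add: convolve_def sum_distrib_right del: iterated_sumset.simps)
  finally show ?case unfolding e_def .
qed

lemma exp_sum_norm_square:
  assumes A: "finite A"
  shows "of_real ((norm (\<Sum>y\<in>A. additive_char (of_real (x * of_int y))))\<^sup>2)
    = (\<Sum>d\<in>differences A. of_real (real (diff_rep A d)) * additive_char (of_real (x * of_int d)))"
proof -
  define e where "e m = additive_char (of_real (x * of_int m))" for m :: int
  have ee: "e y * cnj (e z) = e (y - z)" for y z
    unfolding e_def additive_char_of_real by (simp add: cis_cnj cis_mult algebra_simps)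
  have "of_real ((norm (\<Sum>y\<in>A. e y))\<^sup>2) = (\<Sum>y\<in>A. \<Sum>z\<in>A. e (y - z))"
    unfolding complex_norm_square by (simp add: sum_product ee)
  also have "\<dots> = (\<Sum>d\<in>differences A. of_nat (diff_rep A d) * e d)"
    by (rule sum_over_differences[OF A])
  finally show ?thesis unfolding e_def by simp
qed

lemma ex_grid_separating:
  fixes D :: "int set"
  assumes "finite D"
  obtains M0 :: nat where "M0 > 0" "\<And>M d d'. M \<ge> M0 \<Longrightarrow> d \<in> D \<Longrightarrow> d' \<in> D \<Longrightarrow> \<bar>d - d'\<bar> < int M"
proof -
  obtain b :: int where b: "\<And>d. d \<in> D \<Longrightarrow> \<bar>d\<bar> \<le> b"
    using assms by (metis Max_ge finite_imageI imageI)
  have "\<bar>d - d'\<bar> < int M" if "M \<ge> nat (2 * b) + 1" "d \<in> D" "d' \<in> D" for M d d'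
    using b[OF that(2)] b[OF that(3)] that(1) by linarith
  then show ?thesis using that[of "nat (2 * b) + 1"] by auto
qed

text \<open>
  The \<open>2 k\<close>-th moment is taken over the grid \<open>l / M\<close> rather than over \<open>[0, 1]\<close>; for \<open>M\<close>
  large in terms of the frequencies the two coincide.
\<close>

definition moment_exponent :: "nat \<Rightarrow> real \<Rightarrow> bool" where
  "moment_exponent k t \<longleftrightarrow> (\<forall>\<epsilon>>0. \<exists>C\<ge>0. \<forall>a N. convex_increasing a \<longrightarrow> N \<ge> 1 \<longrightarrow>
     (\<exists>M0>0. \<forall>M\<ge>M0. (\<Sum>l<M. norm (exp_sum a N (real l / real M)) ^ (2 * k))
        \<le> real M * (C * real N powr (t + \<epsilon>))))"

text \<open>The \<open>2 k\<close>-th power of the norm is the squared norm of the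
  \<open>k\<close>-th power, whose coefficients are \<open>sum_rep\<close>.\<close>

lemma moment_exponent_iterated: "moment_exponent k (2 * real k - 2 + 2 powr (1 - real k))"
  unfolding moment_exponent_def
proof (intro allI impI)
  fix \<epsilon> :: real assume \<epsilon>: "\<epsilon> > 0"
  define t where "t = 2 * real k - 2 + 2 powr (1 - real k)"
  obtain C where C: "C \<ge> 0" "\<And>a N. convex_increasing a \<Longrightarrow> N \<ge> 1 \<Longrightarrow>
     (\<Sum>x\<in>iterated_sumset (a ` {..<N}) k. (sum_rep (a ` {..<N}) k x)\<^sup>2) \<le> C * real N powr t"
    using convex_iterated_energy_bound[of k] unfolding t_def by blast
  show "\<exists>C\<ge>0. \<forall>a N. convex_increasing a \<longrightarrow> N \<ge> 1 \<longrightarrow>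
     (\<exists>M0>0. \<forall>M\<ge>M0. (\<Sum>l<M. norm (exp_sum a N (real l / real M)) ^ (2 * k))
        \<le> real M * (C * real N powr (t + \<epsilon>)))"
  proof (intro exI[of _ C] conjI allI impI C(1))
    fix a N assume a: "convex_increasing a" and N: "N \<ge> (1::nat)"
    define A where "A = a ` {..<N}"
    have A: "finite A" unfolding A_def by simp
    have fin: "finite (iterated_sumset A k)" using A by (rule finite_iterated_sumset)
    obtain M0 where M0: "M0 > 0" "\<And>M d d'. M \<ge> M0 \<Longrightarrow> d \<in> iterated_sumset A k \<Longrightarrow> d' \<in> iterated_sumset A k \<Longrightarrow> \<bar>d - d'\<bar> < int M"
      using ex_grid_separating[OF fin] by metis
    have "(\<Sum>l<M. norm (exp_sum a N (real l / real M)) ^ (2 * k)) \<le> real M * (C * real N powr (t + \<epsilon>))"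
      if M: "M \<ge> M0" for M
    proof -
      have "norm (exp_sum a N x) ^ (2 * k) = (norm (\<Sum>m\<in>iterated_sumset A k.
           of_real (sum_rep A k m) * additive_char (of_real (x * of_int m))))\<^sup>2" for x
        unfolding exp_sum_power[OF A, symmetric] exp_sum_image[OF convex_increasing_inj[OF a]]
          A_def[symmetric] norm_power by (rule power_even_eq)
      then have "(\<Sum>l<M. norm (exp_sum a N (real l / real M)) ^ (2 * k))
          = real M * (\<Sum>m\<in>iterated_sumset A k. (sum_rep A k m)\<^sup>2)"
        using discrete_parseval[OF fin, of M "sum_rep A k"] M0(1) M0(2)[OF M] M by simp
      also have "\<dots> \<le> real M * (C * real N powr t)"
        using C(2)[OF a N] unfolding A_def by (intro mult_left_mono) auto
      also have "\<dots> \<le> real M * (C * real N powr (t + \<epsilon>))"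
        using N \<epsilon> C(1) by (intro mult_left_mono powr_mono) auto
      finally show ?thesis .
    qed
    then show "\<exists>M0>0. \<forall>M\<ge>M0. (\<Sum>l<M. norm (exp_sum a N (real l / real M)) ^ (2 * k))
        \<le> real M * (C * real N powr (t + \<epsilon>))"
      using M0(1) by blast
  qed
qed

text \<open>The fourth power is read as the square of the squared norm, whose coefficients are
  \<open>diff_rep\<close>. Thus Parseval yields the energy of differences, and the
  \<open>\<epsilon>\<close> of \<open>moment_exponent\<close> absorbs its logarithms.\<close>

lemma moment_exponent_four: "moment_exponent 2 (32/13)"
  unfolding moment_exponent_def
proof (intro allI impI)
  fix \<epsilon> :: real assume \<epsilon>: "\<epsilon> > 0"
  obtain C where C: "C \<ge> 0" "\<And>a N. convex_increasing a \<Longrightarrow> N \<ge> 1 \<Longrightarrow>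
     diff_energy 2 (a ` {..<N}) \<le> C * real N powr (32/13 + \<epsilon>)"
    using convex_energy_bound[OF \<epsilon>] by blast
  show "\<exists>C\<ge>0. \<forall>a N. convex_increasing a \<longrightarrow> N \<ge> 1 \<longrightarrow>
     (\<exists>M0>0. \<forall>M\<ge>M0. (\<Sum>l<M. norm (exp_sum a N (real l / real M)) ^ (2 * 2))
        \<le> real M * (C * real N powr (32/13 + \<epsilon>)))"
  proof (intro exI[of _ C] conjI allI impI C(1))
    fix a N assume a: "convex_increasing a" and N: "N \<ge> (1::nat)"
    define A where "A = a ` {..<N}"
    have A: "finite A" unfolding A_def by simp
    have fin: "finite (differences A)" using A by (rule finite_differences)
    obtain M0 where M0: "M0 > 0" "\<And>M d d'. M \<ge> M0 \<Longrightarrow> d \<in> differences A \<Longrightarrow> d' \<in> differences A \<Longrightarrow> \<bar>d - d'\<bar> < int M"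
      using ex_grid_separating[OF fin] by metis
    have "(\<Sum>l<M. norm (exp_sum a N (real l / real M)) ^ (2 * 2)) \<le> real M * (C * real N powr (32/13 + \<epsilon>))"
      if M: "M \<ge> M0" for M
    proof -
      have "norm (exp_sum a N x) ^ (2 * 2) = (norm (\<Sum>d\<in>differences A.
           of_real (real (diff_rep A d)) * additive_char (of_real (x * of_int d))))\<^sup>2" for x
        unfolding exp_sum_norm_square[OF A, symmetric] exp_sum_image[OF convex_increasing_inj[OF a]]
          A_def[symmetric] norm_of_real by (simp only: power_even_eq abs_power2)
      then have "(\<Sum>l<M. norm (exp_sum a N (real l / real M)) ^ (2 * 2)) = real M * diff_energy 2 A"
        unfolding diff_energy_def
        using discrete_parseval[OF fin, of M "\<lambda>d. real (diff_rep A d)"] M0(1) M0(2)[OF M] M by simp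
      also have "\<dots> \<le> real M * (C * real N powr (32/13 + \<epsilon>))"
        using C(2)[OF a N] unfolding A_def by (intro mult_left_mono) auto
      finally show ?thesis .
    qed
    then show "\<exists>M0>0. \<forall>M\<ge>M0. (\<Sum>l<M. norm (exp_sum a N (real l / real M)) ^ (2 * 2))
        \<le> real M * (C * real N powr (32/13 + \<epsilon>))"
      using M0(1) by blast
  qed
qed

section \<open>Covering the large values\<close>

definition cell :: "nat \<Rightarrow> nat \<Rightarrow> real set" where
  "cell Q i = {real i / real Q .. (real i + 1) / real Q}"

definition large_cells :: "(nat \<Rightarrow> int) \<Rightarrow> nat \<Rightarrow> nat \<Rightarrow> real \<Rightarrow> nat set" where
  "large_cells a N Q \<mu> = {i. i < Q \<and> (\<exists>x\<in>cell Q i. \<mu> \<le> norm (exp_sum a N x))}"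

lemma finite_large_cells: "finite (large_cells a N Q \<mu>)"
  unfolding large_cells_def by simp

text \<open>Cells have length \<open>1 / Q\<close>, so by \<open>lip\<close> a sum that reaches
  \<open>\<mu>\<close> somewhere in a cell stays at least \<open>\<mu> / 2\<close> on the whole
  cell. Chebyshev's inequality on the grid then counts such cells.\<close>

lemma card_large_cells_le:
  assumes Q: "Q > 0" and \<mu>: "\<mu> > 0"
    and lip: "2 * pi * (\<Sum>n<N. real_of_int \<bar>a n\<bar>) \<le> real Q * (\<mu> / 2)"
    and M0: "M0 > 0" "\<And>M. M \<ge> M0 \<Longrightarrow>
      (\<Sum>l<M. norm (exp_sum a N (real l / real M)) ^ (2 * k)) \<le> real M * Y"
  shows "real (card (large_cells a N Q \<mu>)) * (\<mu> / 2) ^ (2 * k) \<le> real Q * Y"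
proof -
  \<comment> \<open>A multiple of \<open>Q\<close>, so that cell \<open>i\<close> owns its own run
    of \<open>M0\<close> grid points.\<close>
  define M where "M = Q * M0"
  define h where "h l = norm (exp_sum a N (real l / real M)) ^ (2 * k)" for l
  have "M0 \<le> M" unfolding M_def using Q by simp
  have large: "(\<mu> / 2) ^ (2 * k) \<le> h l" if i: "i \<in> large_cells a N Q \<mu>" and l: "l \<in> {i * M0..<i * M0 + M0}" for i l
  proof -
    obtain x where x: "x \<in> cell Q i" "\<mu> \<le> norm (exp_sum a N x)"
      using i unfolding large_cells_def by blast
    have "real (i * M0) \<le> real l" "real l \<le> real (i * M0 + M0)" using l by (auto simp del: of_nat_mult of_nat_add)
    then have "real l / real M \<in> cell Q i"
      unfolding cell_def M_def using Q M0(1) by (auto simp: field_simps)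
    then have "\<bar>x - real l / real M\<bar> \<le> (real i + 1) / real Q - real i / real Q"
      using x(1) unfolding cell_def by auto
    then have d: "\<bar>x - real l / real M\<bar> \<le> 1 / real Q" by (simp add: add_divide_distrib)
    have "norm (exp_sum a N x - exp_sum a N (real l / real M))
        \<le> 2 * pi * (\<Sum>n<N. real_of_int \<bar>a n\<bar>) * \<bar>x - real l / real M\<bar>"
      by (rule exp_sum_lipschitz)
    also have "\<dots> \<le> (real Q * (\<mu> / 2)) * (1 / real Q)"
      using \<mu> by (intro mult_mono[OF lip d]) auto
    also have "\<dots> = \<mu> / 2" using Q by simp
    finally have "norm (exp_sum a N (real l / real M)) \<ge> \<mu> / 2"
      using x(2) norm_triangle_ineq2[of "exp_sum a N x" "exp_sum a N (real l / real M)"] by linarith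
    then show ?thesis unfolding h_def using \<mu> by (intro power_mono) auto
  qed
  have "real M0 * (real (card (large_cells a N Q \<mu>)) * (\<mu> / 2) ^ (2 * k))
     = (\<Sum>i\<in>large_cells a N Q \<mu>. \<Sum>l\<in>{i * M0..<i * M0 + M0}. (\<mu> / 2) ^ (2 * k))"
    by simp
  also have "\<dots> \<le> (\<Sum>i\<in>large_cells a N Q \<mu>. \<Sum>l\<in>{i * M0..<i * M0 + M0}. h l)"
    by (intro sum_mono large)
  also have "\<dots> \<le> (\<Sum>i<Q. \<Sum>l\<in>{i * M0..<i * M0 + M0}. h l)"
    by (rule sum_mono2) (auto simp: large_cells_def h_def intro!: sum_nonneg)
  also have "\<dots> = (\<Sum>l<M. h l)" unfolding M_def by (rule sum.nat_group)
  also have "\<dots> \<le> real M * Y" unfolding h_def using \<open>M0 \<le> M\<close> by (rule M0(2))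
  also have "\<dots> = real M0 * (real Q * Y)" unfolding M_def by simp
  finally show ?thesis using M0(1) by (simp only: mult_le_cancel_left_pos of_nat_0_less_iff)
qed

section \<open>Reduction of partial sums to dyadic blocks\<close>

lemma exp_sum_add: "exp_sum a (M + N) x = exp_sum a M x + exp_sum (\<lambda>n. a (M + n)) N x"
  unfolding exp_sum_def by (induction N) auto

text \<open>The device of Rademacher and Menshov: rounding \<open>M\<close> down to multiples of
  \<open>2 ^ j\<close> for growing \<open>j\<close> removes at most one aligned block per binary
  digit of \<open>M\<close>.\<close>

lemma exp_sum_dyadic_le:
  assumes "\<And>j i. j < m \<Longrightarrow> (i + 1) * 2 ^ j \<le> M \<Longrightarrow> norm (exp_sum (\<lambda>n. a (i * 2 ^ j + n)) (2 ^ j) x) \<le> \<mu>"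
    and "M < 2 ^ m" "\<mu> \<ge> 0"
  shows "norm (exp_sum a M x) \<le> real m * \<mu>"
proof -
  have step: "norm (exp_sum a M x - exp_sum a (M div 2 ^ j * 2 ^ j) x) \<le> real j * \<mu>" if "j \<le> m" for j
    using that
  proof (induction j)
    case (Suc j)
    define q where "q = M div 2 ^ Suc j"
    have q2: "M div 2 ^ j = 2 * q \<or> M div 2 ^ j = 2 * q + 1"
      unfolding q_def by (simp add: div_mult2_eq mult.commute[of 2]) linarith
    have "norm (exp_sum a (M div 2 ^ j * 2 ^ j) x - exp_sum a (q * 2 ^ Suc j) x) \<le> \<mu>"
      using q2
    proof
      assume *: "M div 2 ^ j = 2 * q + 1"
      have "exp_sum a ((2 * q + 1) * 2 ^ j) x = exp_sum a (2 * q * 2 ^ j) x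
          + exp_sum (\<lambda>n. a (2 * q * 2 ^ j + n)) (2 ^ j) x"
      proof -
        have "(2 * q + 1) * 2 ^ j = 2 * q * 2 ^ j + 2 ^ j" by (simp add: algebra_simps)
        then show ?thesis by (simp only: exp_sum_add)
      qed
      moreover have "norm (exp_sum (\<lambda>n. a (2 * q * 2 ^ j + n)) (2 ^ j) x) \<le> \<mu>"
      proof (rule assms(1))
        show "j < m" using Suc by simp
        show "(2 * q + 1) * 2 ^ j \<le> M" unfolding *[symmetric] by simp
      qed
      ultimately show ?thesis unfolding * by (simp add: mult_ac)
    qed (use assms(3) in \<open>simp add: mult_ac\<close>)
    moreover have "norm (exp_sum a M x - exp_sum a (M div 2 ^ j * 2 ^ j) x) \<le> real j * \<mu>"
      using Suc by simp
    ultimately have "norm (exp_sum a M x - exp_sum a (q * 2 ^ Suc j) x) \<le> real j * \<mu> + \<mu>"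
      using norm_triangle_ineq[of "exp_sum a M x - exp_sum a (M div 2 ^ j * 2 ^ j) x"
        "exp_sum a (M div 2 ^ j * 2 ^ j) x - exp_sum a (q * 2 ^ Suc j) x"] by simp
    then show ?case unfolding q_def by (simp add: algebra_simps)
  qed simp
  show ?thesis using step[of m] assms(2) by (simp add: exp_sum_def)
qed

text \<open>Convergence half of Borel-Cantelli: the cells of all scales from \<open>m0\<close> on
  cover \<open>F\<close>, and their \<open>s\<close>-sums are dominated by a geometric tail of ratio
  \<open>q\<close>, with \<open>q < 1\<close> by the condition on \<open>\<theta>\<close>.\<close>

lemma hausdorff_measure_eq_0I:
  fixes F :: "real set"
  assumes Q: "\<And>m. Q m > 0" and fin: "\<And>m. finite (J m)"
    and cover: "\<And>x. x \<in> F \<Longrightarrow> \<exists>\<^sub>\<infinity>m. \<exists>i\<in>J m. x \<in> cell (Q m) i"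
    and card: "\<forall>\<^sub>F m in sequentially. real (card (J m)) \<le> C * 2 powr (real m * \<theta>)"
    and Qge: "\<And>m. 2 powr (real m * \<kappa>) \<le> real (Q m)" and \<kappa>: "\<kappa> > 0"
    and s: "s > 0" "\<theta> < \<kappa> * s" and C: "C \<ge> 0"
  shows "hausdorff_measure s F = 0"
proof -
  define q where "q = 2 powr (\<theta> - \<kappa> * s)"
  have q: "q > 0" "q < 1" unfolding q_def using s powr_less_mono[of "\<theta> - \<kappa> * s" 0 2] by auto
  have small: "hausdorff_premeasure \<delta> s F \<le> ennreal \<epsilon>" if \<delta>: "\<delta> > 0" and \<epsilon>: "\<epsilon> > 0" for \<delta> \<epsilon>
  proof -
    have "(\<lambda>m. C * q ^ m / (1 - q)) \<longlonglongrightarrow> C * 0 / (1 - q)"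
      using q by (intro tendsto_intros LIMSEQ_power_zero) auto
    then have ev1: "\<forall>\<^sub>F m in sequentially. C * q ^ m / (1 - q) < \<epsilon>"
      using \<epsilon> by (intro order_tendstoD(2)) auto
    have "(\<lambda>m. (2 powr (- \<kappa>)) ^ m) \<longlonglongrightarrow> 0"
      using \<kappa> powr_less_mono[of "- \<kappa>" 0 2] by (intro LIMSEQ_power_zero) auto
    then have ev2: "\<forall>\<^sub>F m in sequentially. (2 powr (- \<kappa>)) ^ m < \<delta>"
      using \<delta> by (intro order_tendstoD(2)) auto
    obtain m0 where m0: "\<And>m. m \<ge> m0 \<Longrightarrow> C * q ^ m / (1 - q) < \<epsilon>"
      "\<And>m. m \<ge> m0 \<Longrightarrow> (2 powr (- \<kappa>)) ^ m < \<delta>"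
      "\<And>m. m \<ge> m0 \<Longrightarrow> real (card (J m)) \<le> C * 2 powr (real m * \<theta>)"
      using eventually_conj[OF ev1 eventually_conj[OF ev2 card]] unfolding eventually_sequentially by blast
    have Qinv: "1 / real (Q m) \<le> (2 powr (- \<kappa>)) ^ m" for m
    proof -
      have "1 / real (Q m) \<le> 1 / 2 powr (real m * \<kappa>)"
        using Qge[of m] Q[of m] by (intro divide_left_mono mult_pos_pos) auto
      also have "\<dots> = (2 powr (- \<kappa>)) ^ m"
      proof -
        have "(2 powr (- \<kappa>)) ^ m = 2 powr (- (real m * \<kappa>))" by (simp add: powr_power mult.commute)
        then show ?thesis by (simp add: powr_minus_divide)
      qed
      finally show ?thesis .
    qed
    have diam: "diameter (cell (Q m) i) = 1 / real (Q m)" for m i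
    proof -
      have "real i / real (Q m) \<le> (real i + 1) / real (Q m)" by (simp add: divide_right_mono)
      then show ?thesis unfolding cell_def by (auto simp: add_divide_distrib)
    qed
    \<comment> \<open>Pairs outside the cover get the empty set, whose diameter 0 contributes
      nothing.\<close>
    define V where "V = (\<lambda>(m, i). if i \<in> J (m + m0) then cell (Q (m + m0)) i else {})"
    define U where "U n = V (prod_decode n)" for n
    have "hausdorff_premeasure \<delta> s F \<le> (\<Sum>n. ennreal (diameter (U n) powr s))"
      unfolding hausdorff_premeasure_def
    proof (rule INF_lower, intro CollectI conjI allI)
      show "F \<subseteq> (\<Union>n. U n)"
      proof
        fix x assume "x \<in> F"
        then obtain m i where "m \<ge> m0" "i \<in> J m" "x \<in> cell (Q m) i"
          using cover unfolding INFM_nat_le by blast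
        then have "x \<in> U (prod_encode (m - m0, i))" unfolding U_def V_def by simp
        then show "x \<in> (\<Union>n. U n)" by blast
      qed
      fix n
      obtain m i where mi: "prod_decode n = (m, i)" by (cases "prod_decode n")
      show "bounded (U n)" unfolding U_def V_def mi cell_def by simp
      have "1 / real (Q (m + m0)) \<le> \<delta>" using Qinv[of "m + m0"] m0(2)[of "m + m0"] by simp
      then show "diameter (U n) \<le> \<delta>" unfolding U_def V_def mi using \<delta> diam by simp
    qed
    also have "\<dots> = (\<Sum>m. \<Sum>i. ennreal (diameter (V (m, i)) powr s))"
      unfolding U_def by (rule suminf_ennreal_2dimen) simp
    also have "\<dots> \<le> (\<Sum>m. ennreal (C * q ^ (m + m0)))"
    proof (intro suminf_le allI)
      fix m
      let ?n = "m + m0"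
      have "(\<Sum>i. ennreal (diameter (V (m, i)) powr s)) = (\<Sum>i\<in>J ?n. ennreal (diameter (V (m, i)) powr s))"
        by (rule suminf_finite) (use fin s in \<open>auto simp: V_def\<close>)
      also have "\<dots> = (\<Sum>i\<in>J ?n. ennreal ((1 / real (Q ?n)) powr s))"
        by (intro sum.cong) (auto simp: V_def diam)
      also have "\<dots> = ennreal (real (card (J ?n)) * (1 / real (Q ?n)) powr s)"
        by (simp add: ennreal_mult' ennreal_of_nat_eq_real_of_nat)
      also have "\<dots> \<le> ennreal (C * q ^ ?n)"
      proof (rule ennreal_leI)
        have "(1 / real (Q ?n)) powr s \<le> ((2 powr (- \<kappa>)) ^ ?n) powr s"
          using Qinv s by (intro powr_mono2) auto
        then have "real (card (J ?n)) * (1 / real (Q ?n)) powr s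
           \<le> (C * 2 powr (real ?n * \<theta>)) * ((2 powr (- \<kappa>)) ^ ?n) powr s"
          using m0(3)[of ?n] C by (intro mult_mono) auto
        also have "\<dots> = C * (2 powr (real ?n * \<theta>) * 2 powr (- real ?n * \<kappa> * s))"
          by (simp add: powr_power powr_powr algebra_simps)
        also have "\<dots> = C * q ^ ?n"
          unfolding q_def powr_add[symmetric] by (simp add: powr_power algebra_simps)
        finally show "real (card (J ?n)) * (1 / real (Q ?n)) powr s \<le> C * q ^ ?n" .
      qed
      finally show "(\<Sum>i. ennreal (diameter (V (m, i)) powr s)) \<le> ennreal (C * q ^ ?n)" .
    qed auto
    also have "\<dots> = ennreal (C * q ^ m0 / (1 - q))"
    proof (rule suminf_ennreal_eq)
      have "(\<lambda>m. C * q ^ m0 * q ^ m) sums (C * q ^ m0 * (1 / (1 - q)))"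
        using q by (intro sums_mult geometric_sums) auto
      then show "(\<lambda>m. C * q ^ (m + m0)) sums (C * q ^ m0 / (1 - q))"
        by (simp add: power_add mult_ac)
    qed (use C q in auto)
    also have "\<dots> \<le> ennreal \<epsilon>" using m0(1)[of m0] by (intro ennreal_leI) simp
    finally show ?thesis .
  qed
  have "hausdorff_premeasure \<delta> s F = 0" if "\<delta> > 0" for \<delta>
  proof -
    have "hausdorff_premeasure \<delta> s F \<le> 0"
      by (rule ennreal_le_epsilon) (use small[OF that] in simp)
    then show ?thesis by simp
  qed
  then show ?thesis unfolding hausdorff_measure_def by (simp add: SUP_eq_const)
qed

lemma eventually_linear_less_powr:
  assumes "\<epsilon> > 0"
  shows "\<forall>\<^sub>F m in sequentially. K * real m < 2 powr (real m * \<epsilon>)"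
proof -
  define q where "q = 2 powr (- \<epsilon>)"
  have q: "0 < q" "q < 1" unfolding q_def using assms powr_less_mono[of "- \<epsilon>" 0 2] by auto
  have "(\<lambda>m. K * (real m * q ^ m)) \<longlonglongrightarrow> K * 0"
    using q powser_times_n_limit_0[of q] by (intro tendsto_mult_left) auto
  then have "\<forall>\<^sub>F m in sequentially. K * (real m * q ^ m) < 1"
    by (intro order_tendstoD(2)) auto
  moreover have "K * (real m * q ^ m) < 1 \<longleftrightarrow> K * real m < 2 powr (real m * \<epsilon>)" for m
  proof -
    have "q ^ m = 1 / 2 powr (real m * \<epsilon>)"
      unfolding q_def by (simp add: powr_power mult.commute powr_minus_divide[symmetric])
    then have "K * (real m * q ^ m) = K * real m / 2 powr (real m * \<epsilon>)" by simp
    then show ?thesis by (simp add: pos_divide_less_eq)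
  qed
  ultimately show ?thesis by simp
qed

lemma eventually_const_less_powr:
  assumes "\<epsilon> > 0"
  shows "\<forall>\<^sub>F m in sequentially. K < 2 powr (real m * \<epsilon>)"
  using eventually_linear_less_powr[OF assms, of "\<bar>K\<bar>"] eventually_ge_at_top[of 1]
proof eventually_elim
  case (elim m)
  have "K \<le> \<bar>K\<bar> * 1" by simp
  also have "\<dots> \<le> \<bar>K\<bar> * real m" using elim by (intro mult_left_mono) auto
  finally show ?case using elim by linarith
qed

section \<open>Growth of strictly convex integer sequences\<close>

lemma strictly_convex_seq_tail:
  assumes f: "strictly_convex_seq f"
  obtains n0 where "n0 \<ge> 1" "convex_increasing (\<lambda>n. f (n0 + n))"
proof -
  define d where "d n = f (n + 1) - f n" for n
  have step: "d n < d (Suc n)" if "n \<ge> 1" for n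
    using f[unfolded strictly_convex_seq_def, rule_format, of "Suc n"] that
    unfolding d_def by simp
  have grow: "d (1 + n) \<ge> d 1 + int n" for n
  proof (induction n)
    case (Suc n)
    then show ?case using step[of "1 + n"] by simp
  qed simp
  \<comment> \<open>Integer gaps that increase strictly gain at least 1 per step, so they are
    positive from this index on.\<close>
  define n0 where "n0 = 1 + nat (1 - d 1)"
  have "d (n0 + n) \<ge> 1" for n
    using grow[of "nat (1 - d 1) + n"] unfolding n0_def by (simp add: add.assoc split: if_splits)
  then have "f (n0 + n) < f (n0 + Suc n)" for n unfolding d_def by (smt (verit) add_Suc_right Suc_eq_plus1)
  moreover have "f (n0 + Suc n) - f (n0 + n) < f (n0 + Suc (Suc n)) - f (n0 + Suc n)" for n
    using step[of "n0 + n"] unfolding d_def n0_def by simp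
  ultimately have "convex_increasing (\<lambda>n. f (n0 + n))"
    unfolding convex_increasing_def strict_mono_Suc_iff by blast
  then show ?thesis using that[of n0] unfolding n0_def by simp
qed

text \<open>For large \<open>m\<close> the shifted block lies among the first
  \<open>n0 + 2 ^ m \<le> 2 * 2 ^ m\<close> terms; \<open>\<epsilon>\<close> absorbs the
  constants.\<close>

lemma sum_abs_growth:
  fixes f :: "nat \<Rightarrow> int"
  assumes avg: "c > 0" "\<forall>\<^sub>F N in sequentially. 1 / real N * (\<Sum>n=1..N. real_of_int \<bar>f n\<bar>) \<le> c * real N powr \<tau>"
    and \<tau>: "\<tau> > 0" and n0: "n0 \<ge> 1" and \<epsilon>: "\<epsilon> > 0"
  shows "\<forall>\<^sub>F m in sequentially.
    2 * pi * (\<Sum>n<2 ^ m. real_of_int \<bar>f (n0 + n)\<bar>) \<le> 2 powr (real m * (\<tau> + 1 + \<epsilon>))"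
proof -
  obtain N1 where N1: "\<And>N. N \<ge> N1 \<Longrightarrow> 1 / real N * (\<Sum>n=1..N. real_of_int \<bar>f n\<bar>) \<le> c * real N powr \<tau>"
    using avg(2) unfolding eventually_sequentially by blast
  show ?thesis
    using eventually_const_less_powr[OF \<epsilon>, of "2 * pi * (c * 2 powr (\<tau> + 1))"]
      eventually_ge_at_top[of N1] eventually_ge_at_top[of n0]
  proof eventually_elim
    case (elim m)
    define N where "N = n0 + 2 ^ m"
    have m2: "m < 2 ^ m" by simp
    have "N \<ge> N1" using elim m2 unfolding N_def by linarith
    have "n0 \<le> 2 ^ m" using elim m2 by linarith
    then have "real n0 \<le> real (2 ^ m)" by (simp only: of_nat_le_iff)
    then have N2: "real N \<le> 2 * 2 ^ m" unfolding N_def by simp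
    have N0: "real N > 0" unfolding N_def by (simp add: add_nonneg_pos)
    have "(\<Sum>n<2 ^ m. real_of_int \<bar>f (n0 + n)\<bar>) = (\<Sum>n\<in>{n0..<n0 + 2 ^ m}. real_of_int \<bar>f n\<bar>)"
      by (rule sum.reindex_bij_witness[where i = "\<lambda>n. n - n0" and j = "\<lambda>n. n0 + n"]) auto
    also have "\<dots> \<le> (\<Sum>n=1..N. real_of_int \<bar>f n\<bar>)"
      by (rule sum_mono2) (use n0 in \<open>auto simp: N_def\<close>)
    also have "\<dots> \<le> c * real N powr \<tau> * real N"
      using N1[OF \<open>N \<ge> N1\<close>] N0 by (simp add: field_simps)
    also have "\<dots> = c * real N powr (\<tau> + 1)" using N0 by (simp add: powr_add)
    also have "\<dots> \<le> c * (2 * 2 ^ m) powr (\<tau> + 1)"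
      using N2 avg(1) \<tau> by (intro mult_left_mono powr_mono2) auto
    also have "\<dots> = c * 2 powr (\<tau> + 1) * 2 powr (real m * (\<tau> + 1))"
      by (simp add: powr_mult powr_powr flip: powr_realpow)
    finally have "2 * pi * (\<Sum>n<2 ^ m. real_of_int \<bar>f (n0 + n)\<bar>)
        \<le> 2 * pi * (c * 2 powr (\<tau> + 1) * 2 powr (real m * (\<tau> + 1)))"
      by (intro mult_left_mono) auto
    also have "\<dots> = 2 * pi * (c * 2 powr (\<tau> + 1)) * 2 powr (real m * (\<tau> + 1))" by simp
    also have "\<dots> \<le> 2 powr (real m * \<epsilon>) * 2 powr (real m * (\<tau> + 1))"
      using elim by (intro mult_right_mono) auto
    also have "\<dots> = 2 powr (real m * (\<tau> + 1 + \<epsilon>))"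
      unfolding powr_add[symmetric] by (simp add: algebra_simps)
    finally show ?case .
  qed
qed

lemma convex_increasing_ge_square:
  assumes g: "convex_increasing g"
  shows "2 * g n \<ge> 2 * g 0 + int n * int n"
proof -
  have d: "g (Suc n) - g n \<ge> int n + 1" for n
  proof (induction n)
    case 0
    show ?case using g unfolding convex_increasing_def strict_mono_Suc_iff by (auto dest: spec[of _ 0])
  next
    case (Suc n)
    have "g (Suc n) - g n < g (Suc (Suc n)) - g (Suc n)"
      using g unfolding convex_increasing_def strict_mono_Suc_iff by blast
    then show ?case using Suc by simp
  qed
  show ?thesis
  proof (induction n)
    case (Suc n)
    then show ?case using d[of n] by (simp add: algebra_simps)
  qed simp
qed

text \<open>Gaps that grow at least linearly force terms of quadratic size on the upper half of each
  dyadic range, hence averages at least of order \<open>N\<close> squared. The result makes the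
  final dimension bounds nonnegative.\<close>

lemma convex_average_exponent_ge_2:
  assumes f: "strictly_convex_seq f" and \<tau>: "\<tau> > 0"
    and avg: "c > 0" "\<forall>\<^sub>F N in sequentially. 1 / real N * (\<Sum>n=1..N. real_of_int \<bar>f n\<bar>) \<le> c * real N powr \<tau>"
  shows "\<tau> \<ge> 2"
proof (rule ccontr)
  assume "\<not> \<tau> \<ge> 2"
  \<comment> \<open>Half of the deficit pays for the loss in \<open>sum_abs_growth\<close> and the
    other half still stays below the exponent 3.\<close>
  define \<epsilon> where "\<epsilon> = (2 - \<tau>) / 2"
  have \<epsilon>: "\<epsilon> > 0" "\<tau> + 1 + \<epsilon> = 3 - \<epsilon>" unfolding \<epsilon>_def using \<open>\<not> \<tau> \<ge> 2\<close> by (auto simp: field_simps)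
  obtain n0 where n0: "n0 \<ge> 1" "convex_increasing (\<lambda>n. f (n0 + n))"
    using strictly_convex_seq_tail[OF f] by blast
  define g where "g n = f (n0 + n)" for n
  have g: "convex_increasing g" using n0(2) unfolding g_def .
  have ev1: "\<forall>\<^sub>F m in sequentially. 2 * pi * (\<Sum>n<2 ^ Suc m. real_of_int \<bar>g n\<bar>)
      \<le> 2 powr (real (Suc m) * (\<tau> + 1 + \<epsilon>))"
    using sum_abs_growth[OF avg \<tau> n0(1) \<epsilon>(1)] unfolding g_def
    by (subst eventually_sequentially_Suc)
  have ev2: "\<forall>\<^sub>F m in sequentially. 4 * \<bar>real_of_int (g 0)\<bar> < 2 powr (real m * 2)"
    by (rule eventually_const_less_powr) simp
  \<comment> \<open>The 32 is the 4 in the lower bound \<open>X ^ 3 / 4\<close> times the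
    \<open>2 ^ 3\<close> lost between \<open>m\<close> and \<open>Suc m\<close>.\<close>
  have ev3: "\<forall>\<^sub>F m in sequentially. 32 < 2 powr (real m * \<epsilon>)"
    by (rule eventually_const_less_powr[OF \<epsilon>(1)])
  obtain m where m: "2 * pi * (\<Sum>n<2 ^ Suc m. real_of_int \<bar>g n\<bar>) \<le> 2 powr (real (Suc m) * (\<tau> + 1 + \<epsilon>))"
    "4 * \<bar>real_of_int (g 0)\<bar> < 2 powr (real m * 2)" "32 < 2 powr (real m * \<epsilon>)"
    using eventually_happens[OF eventually_conj[OF ev1 eventually_conj[OF ev2 ev3]]] by auto
  define X :: real where "X = 2 ^ m"
  have X: "2 powr (real m * 2) = X ^ 2" "2 powr (real m * 3) = X ^ 3"
    unfolding X_def by (simp_all add: powr_powr[symmetric] powr_realpow powr_numeral)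
  have X0: "X > 0" unfolding X_def by simp
  have "X ^ 2 / 4 \<le> real_of_int \<bar>g n\<bar>" if "n \<in> {2 ^ m..<2 ^ Suc m}" for n
  proof -
    have "X \<le> real n" unfolding X_def using that by (metis atLeastLessThan_iff of_nat_le_iff of_nat_numeral of_nat_power)
    then have "X * X \<le> real n * real n" using X0 by (intro mult_mono) auto
    moreover have "real_of_int (2 * g n) \<ge> real_of_int (2 * g 0 + int n * int n)"
      using convex_increasing_ge_square[OF g, of n] by (simp only: of_int_le_iff)
    ultimately have "2 * real_of_int (g n) \<ge> X * X - 2 * \<bar>real_of_int (g 0)\<bar>" by simp
    moreover have "4 * \<bar>real_of_int (g 0)\<bar> < X * X" using m(2) unfolding X by (simp add: power2_eq_square)
    ultimately have "real_of_int (g n) \<ge> X * X / 4" by linarith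
    then show ?thesis by (simp add: power2_eq_square)
  qed
  then have "(\<Sum>n\<in>{2 ^ m..<2 ^ Suc m :: nat}. X ^ 2 / 4) \<le> (\<Sum>n\<in>{2 ^ m..<2 ^ Suc m}. real_of_int \<bar>g n\<bar>)"
    by (rule sum_mono)
  also have "\<dots> \<le> (\<Sum>n<2 ^ Suc m. real_of_int \<bar>g n\<bar>)"
    by (rule sum_mono2) auto
  also have "\<dots> \<le> 2 * pi * (\<Sum>n<2 ^ Suc m. real_of_int \<bar>g n\<bar>)"
    using pi_gt3 mult_right_mono[of 1 "2 * pi" "\<Sum>n<2 ^ Suc m. real_of_int \<bar>g n\<bar>"] by (simp add: sum_nonneg)
  also note m(1)
  also have "(\<Sum>n\<in>{2 ^ m..<2 ^ Suc m :: nat}. X ^ 2 / 4) = X ^ 3 / 4"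
  proof -
    have "card {2 ^ m..<2 ^ Suc m :: nat} = 2 ^ m" by simp
    then have "(\<Sum>n\<in>{2 ^ m..<2 ^ Suc m :: nat}. X ^ 2 / 4) = X * (X ^ 2 / 4)"
      unfolding X_def by (simp only: sum_constant of_nat_power of_nat_numeral)
    then show ?thesis by (simp add: power3_eq_cube power2_eq_square)
  qed
  finally have "X ^ 3 / 4 \<le> 2 powr (real (Suc m) * (3 - \<epsilon>))" unfolding \<epsilon>(2) .
  also have "\<dots> = 2 powr (real m * 3) * 2 powr 3 * 2 powr (- \<epsilon>) * 2 powr (- real m * \<epsilon>)"
    unfolding powr_add[symmetric] by (simp add: algebra_simps)
  also have "\<dots> \<le> X ^ 3 * 8 * 1 * 2 powr (- real m * \<epsilon>)"
    unfolding X using X0 \<epsilon> powr_mono[of "- \<epsilon>" 0 2] by (intro mult_right_mono mult_mono) (auto simp: powr_numeral)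
  finally have "X ^ 3 * (1 / 4) \<le> X ^ 3 * (8 * 2 powr (- real m * \<epsilon>))" by simp
  then have "1 / 4 \<le> 8 * 2 powr (- real m * \<epsilon>)" using X0 by (subst (asm) mult_le_cancel_left_pos) auto
  then have "1 / 4 \<le> 8 / 2 powr (real m * \<epsilon>)" by (simp add: powr_minus_divide)
  then have "2 powr (real m * \<epsilon>) \<le> 32" by (simp add: field_simps)
  then show False using m(3) by linarith
qed

section \<open>Assembling the covers\<close>

lemma ex_cell:
  assumes "x \<in> {0..1}" "Q > 0"
  shows "\<exists>i<Q. x \<in> cell Q i"
proof (cases "x = 1")
  case True
  then show ?thesis using assms by (intro exI[of _ "Q - 1"]) (auto simp: cell_def of_nat_diff field_simps)
next
  case False
  define i where "i = nat \<lfloor>x * real Q\<rfloor>"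
  have x: "0 \<le> x" "x < 1" using assms False by auto
  then have i: "real i \<le> x * real Q" "x * real Q < real i + 1"
    unfolding i_def using assms(2) by (auto simp: of_nat_nat)
  have "x * real Q < 1 * real Q" using x assms(2) by (intro mult_strict_right_mono) auto
  then have "i < Q" using i by linarith
  then show ?thesis using i assms(2) by (intro exI[of _ i]) (auto simp: cell_def field_simps)
qed

text \<open>One cell size and one threshold serve blocks of every length, so that each scale
  \<open>m\<close> yields a single family of equal cells.\<close>

definition dyadic_large_cells :: "(nat \<Rightarrow> int) \<Rightarrow> nat \<Rightarrow> nat \<Rightarrow> real \<Rightarrow> nat set" where
  "dyadic_large_cells g m Q \<mu> =
     (\<Union>j\<in>{..<m}. \<Union>i\<in>{..<2 ^ (m - j)}. large_cells (\<lambda>n. g (i * 2 ^ j + n)) (2 ^ j) Q \<mu>)"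

lemma finite_dyadic_large_cells: "finite (dyadic_large_cells g m Q \<mu>)"
  unfolding dyadic_large_cells_def by (simp add: finite_large_cells)

lemma ex_dyadic_large_cell:
  assumes x: "x \<in> {0..1}" and Q: "Q > 0" and \<mu>: "\<mu> \<ge> 0" and M: "M < 2 ^ m"
    and large: "real m * \<mu> < norm (exp_sum g M x)"
  shows "\<exists>i\<in>dyadic_large_cells g m Q \<mu>. x \<in> cell Q i"
proof -
  have "\<exists>j i. j < m \<and> (i + 1) * 2 ^ j \<le> M \<and> \<not> norm (exp_sum (\<lambda>n. g (i * 2 ^ j + n)) (2 ^ j) x) \<le> \<mu>"
    using exp_sum_dyadic_le[of m M g x \<mu>] M \<mu> large by (meson not_le)
  then obtain j i where ji: "j < m" "(i + 1) * 2 ^ j \<le> M"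
    "\<mu> < norm (exp_sum (\<lambda>n. g (i * 2 ^ j + n)) (2 ^ j) x)" by (auto simp: not_le)
  have "(i + 1) * 2 ^ j < 2 ^ (m - j) * 2 ^ j"
    using ji M by (simp flip: power_add)
  then have "i + 1 < 2 ^ (m - j)" by (rule mult_right_less_imp_less) simp
  then have "i < 2 ^ (m - j)" by simp
  moreover obtain l where l: "l < Q" "x \<in> cell Q l" using ex_cell[OF x Q] by blast
  then have "l \<in> large_cells (\<lambda>n. g (i * 2 ^ j + n)) (2 ^ j) Q \<mu>"
    using ji(3) unfolding large_cells_def by (auto intro: less_imp_le)
  ultimately have "l \<in> dyadic_large_cells g m Q \<mu>"
    using ji(1) unfolding dyadic_large_cells_def by blast
  then show ?thesis using l by blast
qed

text \<open>The \<open>2 ^ (m - j)\<close> blocks of length \<open>2 ^ j\<close> contribute moments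
  of total exponent \<open>m - j + j t\<close>, which is at most \<open>m t\<close> since
  \<open>t \<ge> 1\<close>. All levels together thus lose only a factor \<open>m\<close>.\<close>

lemma card_dyadic_large_cells_le:
  assumes g: "convex_increasing g" and Q: "Q > 0" and \<mu>: "\<mu> > 0" and t: "t \<ge> 1" and C: "C \<ge> 0"
    and lip: "2 * pi * (\<Sum>n<2 ^ m. real_of_int \<bar>g n\<bar>) \<le> real Q * (\<mu> / 2)"
    and mom: "\<And>a N. convex_increasing a \<Longrightarrow> N \<ge> 1 \<Longrightarrow>
      \<exists>M0>0. \<forall>M\<ge>M0. (\<Sum>l<M. norm (exp_sum a N (real l / real M)) ^ (2 * k)) \<le> real M * (C * real N powr t)"
  shows "real (card (dyadic_large_cells g m Q \<mu>)) * (\<mu> / 2) ^ (2 * k)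
    \<le> real m * (real Q * (C * 2 powr (real m * t)))"
proof -
  have one: "real (card (large_cells (\<lambda>n. g (i * 2 ^ j + n)) (2 ^ j) Q \<mu>)) * (\<mu> / 2) ^ (2 * k)
     \<le> real Q * (C * 2 powr (real j * t))" if j: "j < m" and i: "i < 2 ^ (m - j)" for i j
  proof -
    have a: "convex_increasing (\<lambda>n. g (i * 2 ^ j + n))" using g by (rule convex_increasing_shift)
    obtain M0 where M0: "M0 > 0" "\<And>M. M \<ge> M0 \<Longrightarrow>
       (\<Sum>l<M. norm (exp_sum (\<lambda>n. g (i * 2 ^ j + n)) (2 ^ j) (real l / real M)) ^ (2 * k))
          \<le> real M * (C * real (2 ^ j) powr t)"
      using mom[OF a, of "2 ^ j"] by auto
    have "(i + 1) * 2 ^ j \<le> 2 ^ (m - j) * 2 ^ j" using i by (intro mult_right_mono) auto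
    then have le: "i * 2 ^ j + 2 ^ j \<le> 2 ^ m" using j by (simp flip: power_add)
    have "(\<Sum>n<2 ^ j. real_of_int \<bar>g (i * 2 ^ j + n)\<bar>) = (\<Sum>n\<in>{i * 2 ^ j..<i * 2 ^ j + 2 ^ j}. real_of_int \<bar>g n\<bar>)"
      by (rule sum.reindex_bij_witness[where i = "\<lambda>n. n - i * 2 ^ j" and j = "\<lambda>n. i * 2 ^ j + n"]) auto
    also have "\<dots> \<le> (\<Sum>n<2 ^ m. real_of_int \<bar>g n\<bar>)"
      by (rule sum_mono2) (use le in auto)
    finally have "2 * pi * (\<Sum>n<2 ^ j. real_of_int \<bar>g (i * 2 ^ j + n)\<bar>) \<le> 2 * pi * (\<Sum>n<2 ^ m. real_of_int \<bar>g n\<bar>)"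
      by (intro mult_left_mono) auto
    then have "2 * pi * (\<Sum>n<2 ^ j. real_of_int \<bar>g (i * 2 ^ j + n)\<bar>) \<le> real Q * (\<mu> / 2)"
      using lip by linarith
    then have "real (card (large_cells (\<lambda>n. g (i * 2 ^ j + n)) (2 ^ j) Q \<mu>)) * (\<mu> / 2) ^ (2 * k)
      \<le> real Q * (C * real (2 ^ j) powr t)"
      by (rule card_large_cells_le[OF Q \<mu> _ M0])
    also have "real (2 ^ j) powr t = 2 powr (real j * t)" by (simp add: powr_powr flip: powr_realpow)
    finally show ?thesis .
  qed
  have level: "real (card (\<Union>i\<in>{..<2 ^ (m - j)}. large_cells (\<lambda>n. g (i * 2 ^ j + n)) (2 ^ j) Q \<mu>)) * (\<mu> / 2) ^ (2 * k)
     \<le> real Q * (C * 2 powr (real m * t))" if j: "j < m" for j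
  proof -
    have "real (card (\<Union>i\<in>{..<2 ^ (m - j)}. large_cells (\<lambda>n. g (i * 2 ^ j + n)) (2 ^ j) Q \<mu>))
       \<le> real (\<Sum>i<2 ^ (m - j). card (large_cells (\<lambda>n. g (i * 2 ^ j + n)) (2 ^ j) Q \<mu>))"
      by (simp only: of_nat_le_iff) (rule card_UN_le, simp)
    then have "real (card (\<Union>i\<in>{..<2 ^ (m - j)}. large_cells (\<lambda>n. g (i * 2 ^ j + n)) (2 ^ j) Q \<mu>)) * (\<mu> / 2) ^ (2 * k)
       \<le> real (\<Sum>i<2 ^ (m - j). card (large_cells (\<lambda>n. g (i * 2 ^ j + n)) (2 ^ j) Q \<mu>)) * (\<mu> / 2) ^ (2 * k)"
      using \<mu> by (intro mult_right_mono) auto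
    also have "\<dots> = (\<Sum>i<2 ^ (m - j). real (card (large_cells (\<lambda>n. g (i * 2 ^ j + n)) (2 ^ j) Q \<mu>)) * (\<mu> / 2) ^ (2 * k))"
      by (simp only: of_nat_sum sum_distrib_right)
    also have "\<dots> \<le> (\<Sum>i<2 ^ (m - j) :: nat. real Q * (C * 2 powr (real j * t)))"
      by (intro sum_mono one j) auto
    also have "\<dots> = real Q * (C * (2 powr (real (m - j)) * 2 powr (real j * t)))"
      by (simp add: powr_realpow)
    also have "\<dots> \<le> real Q * (C * 2 powr (real m * t))"
    proof -
      have "(real m - real j) * 1 \<le> (real m - real j) * t" using j t by (intro mult_left_mono) auto
      then have "real (m - j) + real j * t \<le> real m * t" using j by (simp add: of_nat_diff algebra_simps)
      then show ?thesis unfolding powr_add[symmetric] using C by (intro mult_left_mono powr_mono) auto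
    qed
    finally show ?thesis .
  qed
  have "real (card (dyadic_large_cells g m Q \<mu>))
     \<le> real (\<Sum>j<m. card (\<Union>i\<in>{..<2 ^ (m - j)}. large_cells (\<lambda>n. g (i * 2 ^ j + n)) (2 ^ j) Q \<mu>))"
    unfolding dyadic_large_cells_def by (simp only: of_nat_le_iff) (rule card_UN_le, simp)
  then have "real (card (dyadic_large_cells g m Q \<mu>)) * (\<mu> / 2) ^ (2 * k)
     \<le> real (\<Sum>j<m. card (\<Union>i\<in>{..<2 ^ (m - j)}. large_cells (\<lambda>n. g (i * 2 ^ j + n)) (2 ^ j) Q \<mu>)) * (\<mu> / 2) ^ (2 * k)"
    using \<mu> by (intro mult_right_mono) auto
  also have "\<dots> = (\<Sum>j<m. real (card (\<Union>i\<in>{..<2 ^ (m - j)}. large_cells (\<lambda>n. g (i * 2 ^ j + n)) (2 ^ j) Q \<mu>)) * (\<mu> / 2) ^ (2 * k))"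
    by (simp only: of_nat_sum sum_distrib_right)
  also have "\<dots> \<le> (\<Sum>j<m. real Q * (C * 2 powr (real m * t)))"
    by (intro sum_mono level) auto
  finally show ?thesis by simp
qed

lemma norm_weyl_sum_le_tail:
  assumes "n0 \<ge> 1" "n0 \<le> N"
  shows "norm (weyl_sum (\<lambda>n. real_of_int (f n)) x N) \<le> real n0 + norm (exp_sum (\<lambda>n. f (n0 + n)) (N + 1 - n0) x)"
proof -
  define e where "e n = additive_char (of_real (x * real_of_int (f n)))" for n
  have e1: "norm (e n) = 1" for n unfolding e_def additive_char_of_real by simp
  have "{1..N} = {1..<n0} \<union> {n0..N}" using assms by auto
  then have "weyl_sum (\<lambda>n. real_of_int (f n)) x N = sum e {1..<n0} + sum e {n0..N}"
    unfolding weyl_sum_def e_def by (simp only: ) (rule sum.union_disjoint, auto)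
  moreover have "sum e {n0..N} = exp_sum (\<lambda>n. f (n0 + n)) (N + 1 - n0) x"
    unfolding exp_sum_def e_def
    by (rule sum.reindex_bij_witness[where i = "\<lambda>n. n0 + n" and j = "\<lambda>n. n - n0"]) (use assms in auto)
  moreover have "norm (sum e {1..<n0}) \<le> real n0"
    using sum_norm_le[of "{1..<n0}" e "\<lambda>_. 1"] e1 by simp
  ultimately show ?thesis using norm_triangle_ineq[of "sum e {1..<n0}" "sum e {n0..N}"] by simp
qed

theorem large_sum_set_measure_0:
  assumes f: "strictly_convex_seq f" and \<tau>: "\<tau> > 0"
    and avg: "c > 0" "\<forall>\<^sub>F N in sequentially. 1 / real N * (\<Sum>n=1..N. real_of_int \<bar>f n\<bar>) \<le> c * real N powr \<tau>"
    and \<alpha>: "0 < \<alpha>" "\<alpha> < 1" and mom: "moment_exponent k t" and t: "t \<ge> 1"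
    and s: "s > 0" "\<tau> + 1 - \<alpha> + t - 2 * real k * \<alpha> < (\<tau> + 1 - \<alpha>) * s"
  shows "hausdorff_measure s (large_sum_set (\<lambda>n. real_of_int (f n)) \<alpha>) = 0"
proof -
  obtain n0 where n0: "n0 \<ge> 1" "convex_increasing (\<lambda>n. f (n0 + n))"
    using strictly_convex_seq_tail[OF f] by blast
  define g where "g n = f (n0 + n)" for n
  have g: "convex_increasing g" using n0(2) unfolding g_def .
  \<comment> \<open>The losses add up to \<open>\<theta> = (\<tau> + 1 - \<alpha> + t - 2 k
    \<alpha>) + (5 + 2 k) \<epsilon>\<close>; this \<open>\<epsilon>\<close> lets them use half of
    the slack in the hypothesis on \<open>s\<close>.\<close>
  define \<epsilon> where "\<epsilon> = ((\<tau> + 1 - \<alpha>) * s - (\<tau> + 1 - \<alpha> + t - 2 * real k * \<alpha>)) / (2 * (5 + 2 * real k))"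
  have \<epsilon>: "\<epsilon> > 0" unfolding \<epsilon>_def using s(2) by (intro divide_pos_pos) auto
  \<comment> \<open>The \<open>3 * \<epsilon>\<close> pays for the growth bound, for the lowered
    threshold \<open>\<mu>\<close>, and for the factor 2 in the Lipschitz condition.\<close>
  define \<kappa> where "\<kappa> = \<tau> + 1 - \<alpha> + 3 * \<epsilon>"
  \<comment> \<open>The exponent of \<open>m Q 2 powr (m (t + \<epsilon>))\<close> divided by the
    \<open>2 k\<close>-th power of \<open>\<mu>\<close>; one of the two \<open>\<epsilon>\<close>
    bounds the factor \<open>m\<close>.\<close>
  define \<theta> where "\<theta> = \<kappa> + t + 2 * \<epsilon> - 2 * real k * (\<alpha> - \<epsilon>)"
  have \<kappa>: "\<kappa> > 0" unfolding \<kappa>_def using \<tau> \<alpha> \<epsilon> by simp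
  have \<theta>: "\<theta> < \<kappa> * s"
  proof -
    have "(2 * (5 + 2 * real k)) * \<epsilon> = (\<tau> + 1 - \<alpha>) * s - (\<tau> + 1 - \<alpha> + t - 2 * real k * \<alpha>)"
    proof -
      have "K * (y / K) = y" if "K > 0" for K y :: real using that by simp
      from this[of "2 * (5 + 2 * real k)"] show ?thesis unfolding \<epsilon>_def by auto
    qed
    moreover have "(5 + 2 * real k) * \<epsilon> > 0" using \<epsilon> by (intro mult_pos_pos) auto
    moreover have "\<epsilon> * s > 0" using \<epsilon> s by simp
    ultimately show ?thesis unfolding \<theta>_def \<kappa>_def by (simp add: algebra_simps)
  qed
  \<comment> \<open>The threshold lies below \<open>2 powr (m \<alpha>)\<close> by a power of
    \<open>2 ^ m\<close>, so that \<open>m\<close> blocks below it cannot produce a large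
    sum.\<close>
  define \<mu> where "\<mu> m = 2 powr (real m * (\<alpha> - \<epsilon>))" for m :: nat
  define Q where "Q m = nat \<lceil>2 powr (real m * \<kappa>)\<rceil>" for m :: nat
  have Q0: "Q m > 0" and Q1: "2 powr (real m * \<kappa>) \<le> real (Q m)" and Q2: "real (Q m) \<le> 2 * 2 powr (real m * \<kappa>)" for m
  proof -
    have "2 powr (real m * \<kappa>) \<ge> 1" using \<kappa> by (simp add: ge_one_powr_ge_zero)
    then show "Q m > 0" "2 powr (real m * \<kappa>) \<le> real (Q m)" "real (Q m) \<le> 2 * 2 powr (real m * \<kappa>)"
      unfolding Q_def by linarith+
  qed
  have \<mu>0: "\<mu> m > 0" for m unfolding \<mu>_def by simp
  obtain C where C: "C \<ge> 0" "\<And>a N. convex_increasing a \<Longrightarrow> N \<ge> 1 \<Longrightarrow>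
     \<exists>M0>0. \<forall>M\<ge>M0. (\<Sum>l<M. norm (exp_sum a N (real l / real M)) ^ (2 * k)) \<le> real M * (C * real N powr (t + \<epsilon>))"
    using mom \<epsilon> unfolding moment_exponent_def by blast
  show ?thesis
  proof (rule hausdorff_measure_eq_0I[where Q = Q and J = "\<lambda>m. dyadic_large_cells g m (Q m) (\<mu> m)"
        and C = "2 * C * 2 ^ (2 * k)"])
    show "\<forall>\<^sub>F m in sequentially. real (card (dyadic_large_cells g m (Q m) (\<mu> m)))
        \<le> 2 * C * 2 ^ (2 * k) * 2 powr (real m * \<theta>)"
      using sum_abs_growth[OF avg \<tau> n0(1) \<epsilon>] eventually_const_less_powr[OF \<epsilon>, of 2]
        eventually_linear_less_powr[OF \<epsilon>, of 1]
    proof eventually_elim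
      case (elim m)
      have "2 powr (real m * (\<tau> + 1 + \<epsilon>)) * 2 \<le> 2 powr (real m * (\<tau> + 1 + \<epsilon>)) * 2 powr (real m * \<epsilon>)"
        using elim by (intro mult_left_mono) auto
      also have "\<dots> = 2 powr (real m * \<kappa>) * \<mu> m"
        unfolding \<mu>_def \<kappa>_def powr_add[symmetric] by (simp add: algebra_simps)
      also have "\<dots> \<le> real (Q m) * \<mu> m" using Q1 \<mu>0[of m] by (intro mult_right_mono) auto
      finally have "2 powr (real m * (\<tau> + 1 + \<epsilon>)) \<le> real (Q m) * (\<mu> m / 2)" by simp
      then have "2 * pi * (\<Sum>n<2 ^ m. real_of_int \<bar>g n\<bar>) \<le> real (Q m) * (\<mu> m / 2)"
        using elim(1) unfolding g_def by linarith
      from card_dyadic_large_cells_le[OF g Q0 \<mu>0 _ C(1) this C(2)]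
      have "real (card (dyadic_large_cells g m (Q m) (\<mu> m))) * (\<mu> m / 2) ^ (2 * k)
         \<le> real m * (real (Q m) * (C * 2 powr (real m * (t + \<epsilon>))))"
        using t \<epsilon> by simp
      also have "\<dots> \<le> 2 powr (real m * \<epsilon>) * ((2 * 2 powr (real m * \<kappa>)) * (C * 2 powr (real m * (t + \<epsilon>))))"
        using elim(3) Q2 C(1) by (intro mult_mono mult_right_mono) auto
      also have "\<dots> = 2 * C * (2 powr (real m * \<epsilon>) * 2 powr (real m * \<kappa>) * 2 powr (real m * (t + \<epsilon>)))"
        by simp
      also have "\<dots> = 2 * C * (2 powr (real m * \<theta>) * 2 powr (real m * (\<alpha> - \<epsilon>) * real (2 * k)))"
        unfolding powr_add[symmetric] \<theta>_def by (simp add: algebra_simps)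
      also have "\<dots> = 2 * C * 2 ^ (2 * k) * 2 powr (real m * \<theta>) * (\<mu> m / 2) ^ (2 * k)"
        unfolding \<mu>_def by (simp add: power_divide powr_power mult_ac del: of_nat_mult)
      finally show ?case using \<mu>0[of m] by (subst (asm) mult_le_cancel_right_pos) auto
    qed
    fix x assume "x \<in> large_sum_set (\<lambda>n. real_of_int (f n)) \<alpha>"
    then have x: "x \<in> {0..1}" and inf: "\<exists>\<^sub>\<infinity>N. norm (weyl_sum (\<lambda>n. real_of_int (f n)) x N) \<ge> real N powr \<alpha>"
      unfolding large_sum_set_def by auto
    obtain m1 where m1: "\<And>m. m \<ge> m1 \<Longrightarrow> 4 * real m < 2 powr (real m * \<epsilon>)"
      "\<And>m. m \<ge> m1 \<Longrightarrow> 4 * real n0 < 2 powr (real m * \<alpha>)"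
      using eventually_conj[OF eventually_linear_less_powr[OF \<epsilon>, of 4] eventually_const_less_powr[OF \<alpha>(1), of "4 * real n0"]]
      unfolding eventually_sequentially by blast
    show "\<exists>\<^sub>\<infinity>m. \<exists>i\<in>dyadic_large_cells g m (Q m) (\<mu> m). x \<in> cell (Q m) i"
      unfolding INFM_nat_le
    proof
      fix m2
      define m3 where "m3 = max m1 m2"
      obtain N where N: "N \<ge> 2 ^ m3 + n0" "norm (weyl_sum (\<lambda>n. real_of_int (f n)) x N) \<ge> real N powr \<alpha>"
        using inf unfolding INFM_nat_le by blast
      have "N \<ge> 1" using N(1) n0 by simp
      then obtain p where p: "2 ^ p \<le> N" "N < 2 ^ (p + 1)" using ex_power_ivl1[of 2 N] by auto
      \<comment> \<open>\<open>N < 2 ^ m\<close> puts the tail sum in range, while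
        \<open>N \<ge> 2 ^ (m - 1)\<close> and \<open>\<alpha> < 1\<close> cost at most a factor 2.
        The discarded first terms cost at most another quarter of
        \<open>2 powr (m \<alpha>)\<close>.\<close>
      define m where "m = p + 1"
      have "(2::nat) ^ m3 < 2 ^ m" using N(1) p(2) unfolding m_def by linarith
      then have m: "m \<ge> m1" "m \<ge> m2" unfolding m3_def by auto
      have "2 powr (real m * \<alpha>) / 2 \<le> 2 powr (real p * \<alpha>)"
      proof -
        have "2 powr (real m * \<alpha>) = 2 powr (real p * \<alpha>) * 2 powr \<alpha>"
          unfolding m_def powr_add[symmetric] by (simp add: algebra_simps)
        moreover have "2 powr \<alpha> \<le> 2 powr 1" using \<alpha> by (intro powr_mono) auto
        ultimately show ?thesis by simp
      qed
      also have "\<dots> = real (2 ^ p) powr \<alpha>" by (simp add: powr_powr flip: powr_realpow)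
      also have "\<dots> \<le> real N powr \<alpha>"
        using p(1) \<alpha> by (intro powr_mono2) (auto simp del: of_nat_power)
      also have "\<dots> \<le> real n0 + norm (exp_sum g (N + 1 - n0) x)"
        using N norm_weyl_sum_le_tail[of n0 N f x] n0(1) unfolding g_def by linarith
      finally have lower: "2 powr (real m * \<alpha>) / 4 < norm (exp_sum g (N + 1 - n0) x)"
        using m1(2)[OF m(1)] by linarith
      have "real m * \<mu> m * 4 = 4 * real m * \<mu> m" by simp
      also have "\<dots> \<le> 2 powr (real m * \<epsilon>) * \<mu> m"
        using m1(1)[OF m(1)] \<mu>0[of m] by (intro mult_right_mono) auto
      also have "\<dots> = 2 powr (real m * \<alpha>)"
        unfolding \<mu>_def powr_add[symmetric] by (simp add: algebra_simps)
      finally have "real m * \<mu> m < norm (exp_sum g (N + 1 - n0) x)" using lower by linarith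
      moreover have "N + 1 - n0 < 2 ^ m" using p(2) n0(1) unfolding m_def by linarith
      ultimately have "\<exists>i\<in>dyadic_large_cells g m (Q m) (\<mu> m). x \<in> cell (Q m) i"
        using ex_dyadic_large_cell[OF x Q0, of "\<mu> m" "N + 1 - n0" m g] \<mu>0[of m] by simp
      then show "\<exists>n\<ge>m2. \<exists>i\<in>dyadic_large_cells g n (Q n) (\<mu> n). x \<in> cell (Q n) i"
        using m(2) by blast
    qed
  qed (use Q0 Q1 \<kappa> s \<theta> C(1) finite_dyadic_large_cells in auto)
qed

lemma hausdorff_dim_leI:
  assumes "u \<ge> 0" "\<And>s. s > u \<Longrightarrow> hausdorff_measure s A = 0"
  shows "hausdorff_dim A \<le> ereal u"
proof (rule ereal_le_epsilon2)
  fix e :: real assume "e > 0"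
  then have "hausdorff_dim A \<le> ereal (u + e)"
    unfolding hausdorff_dim_def using assms by (intro INF_lower) auto
  then show "hausdorff_dim A \<le> ereal u + ereal e" by simp
qed

theorem theorem3p6:
  fixes f :: "nat \<Rightarrow> int" and \<tau> \<alpha> :: real
  assumes "strictly_convex_seq f"
    and "\<tau> > 0"
    and "\<exists>c>0. \<forall>\<^sub>F N in sequentially.
           1 / real N * (\<Sum>n=1..N. real_of_int \<bar>f n\<bar>) \<le> c * real N powr \<tau>"
    and "1/2 < \<alpha>" and "\<alpha> < 1"
  shows "hausdorff_dim (large_sum_set (\<lambda>n. real_of_int (f n)) \<alpha>)
           \<le> ereal (min (U1 \<tau> \<alpha>) (U2 \<tau> \<alpha>))"
proof -
  obtain c where avg: "c > 0" "\<forall>\<^sub>F N in sequentially.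
      1 / real N * (\<Sum>n=1..N. real_of_int \<bar>f n\<bar>) \<le> c * real N powr \<tau>"
    using assms(3) by blast
  \<comment> \<open>Needed for the condition \<open>pos\<close> below, both for \<open>U1\<close>
    and for every term of \<open>U2\<close>.\<close>
  have \<tau>2: "\<tau> \<ge> 2" by (rule convex_average_exponent_ge_2[OF assms(1,2) avg])
  define d where "d = \<tau> + 1 - \<alpha>"
  have d: "d > 0" unfolding d_def using \<tau>2 assms by simp
  define F where "F = large_sum_set (\<lambda>n. real_of_int (f n)) \<alpha>"
  have bound: "hausdorff_dim F \<le> ereal ((d + t - 2 * real k * \<alpha>) / d)"
    if mom: "moment_exponent k t" and t: "t \<ge> 1" and pos: "0 \<le> d + t - 2 * real k * \<alpha>" for k t
  proof (rule hausdorff_dim_leI)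
    show u0: "0 \<le> (d + t - 2 * real k * \<alpha>) / d" using pos d by simp
    fix s assume "(d + t - 2 * real k * \<alpha>) / d < s"
    then have "s > 0" "d + t - 2 * real k * \<alpha> < d * s"
      using d u0 by (linarith, simp add: pos_divide_less_eq mult.commute)
    then show "hausdorff_measure s F = 0"
      unfolding F_def d_def using assms(4,5)
      by (intro large_sum_set_measure_0[OF assms(1,2) avg _ _ mom t]) auto
  qed
  \<comment> \<open>Here \<open>1 + 32/13 = 45/13\<close>, and
    \<open>- \<alpha> - 4 \<alpha>\<close> gives \<open>- 5 \<alpha>\<close>.\<close>
  have "hausdorff_dim F \<le> ereal (U1 \<tau> \<alpha>)"
    using bound[OF moment_exponent_four] \<tau>2 assms(5) unfolding U1_def d_def by (simp add: algebra_simps)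
  moreover have "hausdorff_dim F \<le> ereal (U2 \<tau> \<alpha>)"
  proof -
    define u where "u k = (\<tau> - \<alpha> + 2 * real k - 1 + 2 powr (- real k + 1) - 2 * real k * \<alpha>) / (\<tau> + 1 - \<alpha>)" for k :: nat
    have uk: "hausdorff_dim F \<le> ereal (u k)" if k: "k \<ge> 3" for k
    proof -
      define t where "t = 2 * real k - 2 + 2 powr (1 - real k)"
      have p: "2 powr (1 - real k) > 0" by simp
      have "2 * real k * \<alpha> \<le> 2 * real k * 1" using assms(5) by (intro mult_left_mono) auto
      then have "0 \<le> d + t - 2 * real k * \<alpha>" using \<tau>2 assms(5) p unfolding d_def t_def by linarith
      moreover have "t \<ge> 1" using k p unfolding t_def by linarith
      ultimately have "hausdorff_dim F \<le> ereal ((d + t - 2 * real k * \<alpha>) / d)"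
        using moment_exponent_iterated[of k] bound[of k t] unfolding t_def by blast
      then show ?thesis unfolding u_def d_def t_def by (simp add: algebra_simps)
    qed
    show ?thesis
    \<comment> \<open>\<open>U2\<close> is an infimum of reals, so the bounds for the single
      \<open>k\<close> are combined at a real value of the dimension; \<open>k = 3\<close> already
      excludes infinity.\<close>
    proof (cases "hausdorff_dim F")
      case (real h)
      have "h \<le> u k" if "k \<ge> 3" for k using uk[OF that] real by simp
      then have "h \<le> (INF k\<in>{3..}. u k)" by (intro cINF_greatest) auto
      then show ?thesis unfolding U2_def u_def real by simp
    next
      case PInf
      then show ?thesis using uk[of 3] by simp
    next
      case MInf
      then show ?thesis by simp
    qed
  qed
  ultimately show ?thesis unfolding F_def by (simp add: min_def)
qed

end
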